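(* Let $\mathcal{A}$ be a locally $C^*$-algebra and $\mathcal{H}$ a Hilbert module over $\mathcal{A}$. Let $\mathcal{B}$ be a locally $C^*$-algebra and let $\phi\colon\mathcal{B}\to\mathcal{L}^*(\mathcal{H})$ be a continuous and completely positive map. Then, for any $b\in\mathcal{B}$ and any $p\in S_*(\mathcal{A})$, there exists a constant $c_p(b)\ge0$ such that, for all $n\in\mathbb{N}$, $h_1,\dots,h_n\in\mathcal{H}$, $x_1,\dots,x_n\in\mathcal{B}$, $$p\Bigl(\sum_{i,j=1}^n[\phi(x_i^*b^*bx_j)h_j,h_i]_{\mathcal{H}}\Bigr)\le c_p(b)\,p\Bigl(\sum_{i,j=1}^n[\phi(x_i^*x_j)h_j,h_i]_{\mathcal{H}}\Bigr).$$
   Context: A locally $C^*$-algebra $\mathcal{A}$ is a complex $*$-algebra (not necessarily unital) with a complete Hausdorff topology induced by a family of $C^*$-seminorms, i.e. seminorms $p$ with $p(a^*a)=p(a)^2$. $S_*(\mathcal{A})$ is the set of all continuous $C^*$-seminorms on $\mathcal{A}$. The positive elements are those of the form $a^*a$. A Hilbert module over $\mathcal{A}$ is a complex vector space and right $\mathcal{A}$-module $\mathcal{H}$ with a gramian $[\cdot,\cdot]\colon\mathcal{H}\times\mathcal{H}\to\mathcal{A}$, linear in the second variable, with $[x,y]=[y,x]^*$, $[x,x]\ge0$, $[x,x]=0$ iff $x=0$, and $[e,fa+gb]=[e,f]a+[e,g]b$, which is complete in the topology given by the seminorms $\tilde p(h)=p([h,h])^{1/2}$, $p\in S_*(\mathcal{A})$.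 $\mathcal{L}^*(\mathcal{H})$ is the $*$-algebra of adjointable operators, i.e. linear $T\colon\mathcal{H}\to\mathcal{H}$ for which there is a linear $T^*$ with $[Th,k]=[h,T^*k]$. For $p\in S_*(\mathcal{A})$ and $T\in\mathcal{L}^*(\mathcal{H})$, $\overline p(T)$ is the infimum of all $C\ge0$ with $\tilde p(Th)\le C\tilde p(h)$ for all $h\in\mathcal{H}$ (this is finite); with the $C^*$-seminorms $\overline p$, $p\in S_*(\mathcal{A})$, $\mathcal{L}^*(\mathcal{H})$ is a locally $C^*$-algebra, and continuity of $\phi$ refers to this topology. For a locally $C^*$-algebra $\mathcal{C}$, the $*$-algebra $M_n(\mathcal{C})$ of $n\times n$ matrices over $\mathcal{C}$ is a locally $C^*$-algebra with the seminorms $p_n([a_{ij}])=\|[a_{ij}+\mathcal{I}_p]\|_{M_n(\mathcal{C}/\mathcal{I}_p)}$, $p\in S_*(\mathcal{C})$, where $\mathcal{I}_p=\{a\mid p(a)=0\}$ and $\mathcal{C}/\mathcal{I}_p$ is a $C^*$-algebra with norm induced by $p$. A linear map $\phi\colon\mathcal{C}\to\mathcal{D}$ between locally $C^*$-algebras is completely positive if for every $n\in\mathbb{N}$ the map $M_n(\mathcal{C})\ni[a_{ij}]\mapsto[\phi(a_{ij})]\in M_n(\mathcal{D})$ maps positive elements to positive elements. *)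

theory Defs
  imports "HOL-Analysis.Analysis" "HOL-Library.Function_Algebras"
begin

section \<open>Complex vector spaces\<close>

class scaleC =
  fixes scaleC :: "complex \<Rightarrow> 'a \<Rightarrow> 'a"  (infixr "*\<^sub>C" 75)

class complex_vector = ab_group_add + scaleC +
  assumes scaleC_add_right: "c *\<^sub>C (x + y) = c *\<^sub>C x + c *\<^sub>C y"
    and scaleC_add_left: "(c + d) *\<^sub>C x = c *\<^sub>C x + d *\<^sub>C x"
    and scaleC_scaleC: "c *\<^sub>C d *\<^sub>C x = (c * d) *\<^sub>C x"
    and scaleC_one: "1 *\<^sub>C x = x"

instantiation "fun" :: (type, complex_vector) complex_vector
begin

definition scaleC_fun :: "complex \<Rightarrow> ('a \<Rightarrow> 'b) \<Rightarrow> 'a \<Rightarrow> 'b"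
  where "scaleC_fun c f = (\<lambda>x. c *\<^sub>C f x)"

instance
  by standard
    (simp_all add: scaleC_fun_def fun_eq_iff scaleC_add_right scaleC_add_left
      scaleC_scaleC scaleC_one)

end

abbreviation clinear :: "('a::complex_vector \<Rightarrow> 'b::complex_vector) \<Rightarrow> bool"
  where "clinear \<equiv> Vector_Spaces.linear scaleC scaleC"

definition (in complex_vector) seminorm :: "('a \<Rightarrow> real) \<Rightarrow> bool"
  where "seminorm p \<longleftrightarrow>
    (\<forall>x. 0 \<le> p x) \<and> (\<forall>x y. p (x + y) \<le> p x + p y) \<and> (\<forall>c x. p (c *\<^sub>C x) = cmod c * p x)"

text \<open>Its associated topology is the one induced by the seminorms in \<open>P\<close>.\<close>

definition (in minus) seminorm_uniformity :: "('a \<Rightarrow> real) set \<Rightarrow> ('a \<times> 'a) filter"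
  where "seminorm_uniformity P =
    (INF p\<in>P. INF e\<in>{0<..}. principal {(x, y). p (x - y) < e})"


section \<open>Locally \<open>C\<^sup>*\<close>-algebras\<close>

class complex_star_algebra = ring + complex_vector +
  fixes star :: "'a \<Rightarrow> 'a"
  assumes scaleC_mult_left: "(c *\<^sub>C x) * y = c *\<^sub>C (x * y)"
    and scaleC_mult_right: "x * (c *\<^sub>C y) = c *\<^sub>C (x * y)"
    and star_star: "star (star x) = x"
    and star_add: "star (x + y) = star x + star y"
    and star_scaleC: "star (c *\<^sub>C x) = cnj c *\<^sub>C star x"
    and star_mult: "star (x * y) = star y * star x"

text \<open>Submultiplicativity and \<open>p (star a) = p a\<close> follow from this (Sebestyen's theorem).\<close>

definition (in complex_star_algebra) cstar_seminorm :: "('a \<Rightarrow> real) \<Rightarrow> bool"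
  where "cstar_seminorm p \<longleftrightarrow> seminorm p \<and> (\<forall>a. p (star a * a) = (p a)\<^sup>2)"

class locally_cstar_algebra = complex_star_algebra + uniform_space + t2_space +
  assumes uniformity_cstar_seminorms:
      "\<exists>P. (\<forall>p\<in>P. cstar_seminorm p) \<and> uniformity = seminorm_uniformity P"
    and complete_locally_cstar: "complete (UNIV :: 'a set)"

definition cont_cstar_seminorms :: "('a::locally_cstar_algebra \<Rightarrow> real) set"  ("S\<^sub>*")
  where "S\<^sub>* = {p. cstar_seminorm p \<and> continuous_on UNIV p}"


section \<open>Positivity and complete positivity\<close>

text \<open>
  A \<open>*\<close>-algebra is here a carrier \<open>C\<close> in some type together with a multiplication \<open>m\<close> and an
  involution \<open>s\<close>; addition is that of the type.  In this way the same notions apply to a whole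
  type, to an algebra of operators on a module (multiplied by composition), and to matrices
  over either.
\<close>

definition positives :: "'x set \<Rightarrow> ('x \<Rightarrow> 'x \<Rightarrow> 'x) \<Rightarrow> ('x \<Rightarrow> 'x) \<Rightarrow> 'x set"
  where "positives C m s = {m (s a) a |a. a \<in> C}"

text \<open>An \<open>n \<times> n\<close> matrix is a doubly indexed family that vanishes outside the index range.\<close>

definition mat_carrier :: "nat \<Rightarrow> 'x::zero set \<Rightarrow> (nat \<Rightarrow> nat \<Rightarrow> 'x) set"
  where "mat_carrier n C =
    {X. \<forall>i j. if i < n \<and> j < n then X i j \<in> C else X i j = 0}"

definition mat_mult :: "nat \<Rightarrow> ('x \<Rightarrow> 'x \<Rightarrow> 'x) \<Rightarrow> (nat \<Rightarrow> nat \<Rightarrow> 'x) \<Rightarrow> (nat \<Rightarrow> nat \<Rightarrow> 'x)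
    \<Rightarrow> nat \<Rightarrow> nat \<Rightarrow> 'x::comm_monoid_add"
  where "mat_mult n m X Y = (\<lambda>i j. if i < n \<and> j < n then \<Sum>k<n. m (X i k) (Y k j) else 0)"

definition mat_star :: "nat \<Rightarrow> ('x \<Rightarrow> 'x) \<Rightarrow> (nat \<Rightarrow> nat \<Rightarrow> 'x) \<Rightarrow> nat \<Rightarrow> nat \<Rightarrow> 'x::zero"
  where "mat_star n s X = (\<lambda>i j. if i < n \<and> j < n then s (X j i) else 0)"

definition mat_map :: "nat \<Rightarrow> ('x \<Rightarrow> 'y) \<Rightarrow> (nat \<Rightarrow> nat \<Rightarrow> 'x) \<Rightarrow> nat \<Rightarrow> nat \<Rightarrow> 'y::zero"
  where "mat_map n f X = (\<lambda>i j. if i < n \<and> j < n then f (X i j) else 0)"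

definition mat_positives :: "nat \<Rightarrow> 'x::comm_monoid_add set \<Rightarrow> ('x \<Rightarrow> 'x \<Rightarrow> 'x) \<Rightarrow> ('x \<Rightarrow> 'x)
    \<Rightarrow> (nat \<Rightarrow> nat \<Rightarrow> 'x) set"
  where "mat_positives n C m s = positives (mat_carrier n C) (mat_mult n m) (mat_star n s)"

definition completely_positive :: "'d::complex_vector set \<Rightarrow> ('d \<Rightarrow> 'd \<Rightarrow> 'd) \<Rightarrow> ('d \<Rightarrow> 'd)
    \<Rightarrow> ('c::complex_star_algebra \<Rightarrow> 'd) \<Rightarrow> bool"
  where "completely_positive D m s f \<longleftrightarrow> clinear f \<and> range f \<subseteq> D \<and>
    (\<forall>n. mat_map n f ` mat_positives n UNIV (*) star \<subseteq> mat_positives n D m s)"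


section \<open>Hilbert modules\<close>

definition hnorm :: "('h \<Rightarrow> 'h \<Rightarrow> 'a) \<Rightarrow> ('a \<Rightarrow> real) \<Rightarrow> 'h \<Rightarrow> real"
  where "hnorm gram p h = sqrt (p (gram h h))"

locale hilbert_module =
  fixes act :: "'h::{complex_vector,uniform_space} \<Rightarrow> 'a::locally_cstar_algebra \<Rightarrow> 'h"
      (infixl "\<cdot>" 70)
    and gram :: "'h \<Rightarrow> 'h \<Rightarrow> 'a"
  assumes act_add_left: "(g + h) \<cdot> a = g \<cdot> a + h \<cdot> a"
    and act_add_right: "h \<cdot> (a + b) = h \<cdot> a + h \<cdot> b"
    and act_mult: "h \<cdot> (a * b) = h \<cdot> a \<cdot> b"
    and gram_linear: "clinear (gram h)"
    and gram_star: "gram g h = star (gram h g)"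
    and gram_positive: "gram h h \<in> positives UNIV (*) star"
    and gram_eq_zero_iff: "gram h h = 0 \<longleftrightarrow> h = 0"
    and gram_act: "gram e (f \<cdot> a + g \<cdot> b) = gram e f * a + gram e g * b"
    and uniformity_hnorm: "uniformity = seminorm_uniformity (hnorm gram ` S\<^sub>*)"
    and complete_hilbert_module: "complete (UNIV :: 'h set)"

definition is_adjoint :: "('h::complex_vector \<Rightarrow> 'h \<Rightarrow> 'a) \<Rightarrow> ('h \<Rightarrow> 'h) \<Rightarrow> ('h \<Rightarrow> 'h) \<Rightarrow> bool"
  where "is_adjoint gram T S \<longleftrightarrow> clinear S \<and> (\<forall>h k. gram (T h) k = gram h (S k))"

definition adjointables :: "('h::complex_vector \<Rightarrow> 'h \<Rightarrow> 'a) \<Rightarrow> ('h \<Rightarrow> 'h) set"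
  where "adjointables gram = {T. clinear T \<and> (\<exists>S. is_adjoint gram T S)}"

definition adjoint_op :: "('h::complex_vector \<Rightarrow> 'h \<Rightarrow> 'a) \<Rightarrow> ('h \<Rightarrow> 'h) \<Rightarrow> 'h \<Rightarrow> 'h"
  where "adjoint_op gram T = (THE S. is_adjoint gram T S)"

text \<open>
  The infimum is taken in \<open>[0, \<infinity>]\<close>, so that it has its usual meaning without first showing that
  every adjointable operator is bounded.
\<close>

definition op_seminorm :: "('h \<Rightarrow> 'h \<Rightarrow> 'a) \<Rightarrow> ('a \<Rightarrow> real) \<Rightarrow> ('h \<Rightarrow> 'h) \<Rightarrow> ennreal"
  where "op_seminorm gram p T =
    Inf {ennreal C |C. 0 \<le> C \<and> (\<forall>h. hnorm gram p (T h) \<le> C * hnorm gram p h)}"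

text \<open>
  The topology of the seminorms \<^const>\<open>op_seminorm\<close>, generated by their open balls.  It is not
  the product topology that the type class instance puts on the function type.
\<close>

definition adjointables_topology ::
    "('h::complex_vector \<Rightarrow> 'h \<Rightarrow> 'a::locally_cstar_algebra) \<Rightarrow> ('h \<Rightarrow> 'h) topology"
  where "adjointables_topology gram = topology_generated_by
    {{T \<in> adjointables gram. op_seminorm gram p (T - T\<^sub>0) < ennreal e} |p T\<^sub>0 e.
      p \<in> S\<^sub>* \<and> T\<^sub>0 \<in> adjointables gram \<and> 0 < e}"

end

theory Submission
  imports Defs
begin

text \<open>
  Fix \<open>b\<close>, \<open>p\<close>, the \<open>x\<^sub>i\<close> and the \<open>h\<^sub>i\<close>; write \<open>S(c) = \<Sum> [\<phi>(x\<^sub>i\<^sup>* c\<^sup>* c x\<^sub>j) h\<^sub>j, h\<^sub>i]\<close>,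
  \<open>S(1) = \<Sum> [\<phi>(x\<^sub>i\<^sup>* x\<^sub>j) h\<^sub>j, h\<^sub>i]\<close> and \<open>F = p \<circ> S\<close>.  The natural idea is to compare \<open>b\<^sup>*b\<close> with
  \<open>q(b)\<^sup>2 1\<close> for a \<open>C\<^sup>*\<close>-seminorm \<open>q\<close> that controls \<open>\<phi>\<close>, but in \<open>B\<close> the inequality between them
  holds only modulo the kernel of \<open>q\<close>.  An iteration avoids the comparison.

  By complete positivity \<open>\<Sum> [\<phi>(y\<^sub>i\<^sup>* y\<^sub>j) h\<^sub>j, h\<^sub>i]\<close> is, for every family \<open>y\<close>, a sum of elements
  \<open>a\<^sup>*a\<close> of \<open>A\<close>.  For \<open>y\<^sub>i = x\<^sub>i - t b\<^sup>*b x\<^sub>i\<close> this says that \<open>2t S(b)\<close> plus such a sum equals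
  \<open>S(1) + t\<^sup>2 S(b\<^sup>*b)\<close>.  Since \<open>p\<close> is monotone on these sums, \<open>2t F(b) \<le> F(1) + t\<^sup>2 F(b\<^sup>*b)\<close> for
  all \<open>t > 0\<close>, that is, \<open>F(b)\<^sup>2 \<le> F(1) F(b\<^sup>*b)\<close>.  Now put \<open>b\<^sub>0 = b\<close>,
  \<open>b\<^sub>k\<^sub>+\<^sub>1 = b\<^sub>k\<^sup>* b\<^sub>k\<close> and iterate.  Continuity of \<open>\<phi>\<close> gives finitely many \<open>C\<^sup>*\<close>-seminorms of \<open>B\<close> such
  that \<open>F(b\<^sub>k) \<le> M (d\<^sup>2)\<close> to the power \<open>2\<^sup>k\<close>, where \<open>d\<close> is their sum at \<open>b\<close>.  The factor \<open>M\<close> depends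
  on the \<open>x\<^sub>i\<close> and \<open>h\<^sub>i\<close>, but it disappears when the root of order \<open>2\<^sup>k\<close> is taken:
  \<open>F(b) \<le> d\<^sup>2 F(1)\<close>, and \<open>d\<close> depends on \<open>b\<close> and \<open>p\<close> only.  These steps are
  \<open>completely_positive_form_star_sums\<close>, \<open>form_square_le\<close>, \<open>geometric_bound\<close> and \<open>form_le\<close>.

  Two facts about a \<open>C\<^sup>*\<close>-seminorm \<open>p\<close> on a \<open>*\<close>-algebra enter: it is submultiplicative and
  \<open>*\<close>-invariant (Sebestyen), and \<open>p(s) \<le> p(s + t)\<close> for sums \<open>s\<close>, \<open>t\<close> of elements \<open>a\<^sup>*a\<close>.  As the
  algebra need not be complete for \<open>p\<close> alone, there is no spectrum to work with; instead
  \<open>1 - u\<close> with \<open>u\<close> of norm at most \<open>1\<close> has approximate square roots that are polynomials in \<open>u\<close>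
  (\<open>approx_sqrt\<close>).  From these, on the unitization: nearly unitary elements \<open>h \<plusminus> ir\<close>
  yield the \<open>C\<^sup>*\<close>-property of the operator seminorm (\<open>op_norm_le_one_of_square\<close>,
  \<open>op_norm_square_le_cstar\<close>); sums and commuting products of positive elements are positive and
  the seminorm is monotone on them (\<open>L_mono\<close>); and \<open>a\<^sup>*a\<close> is positive (\<open>pos_star_mult\<close>), by a
  growth argument that replaces the usual splitting into positive and negative parts.
\<close>

section \<open>Preliminaries\<close>

interpretation cvec: vector_space "scaleC :: complex \<Rightarrow> 'a \<Rightarrow> 'a::complex_vector"
  by standard (simp_all add: scaleC_add_right scaleC_add_left scaleC_scaleC scaleC_one)

lemma scaleC_one_simp [simp]: "1 *\<^sub>C x = (x :: 'a::complex_vector)"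
  by (rule scaleC_one)

lemmas scaleC_distribs = cvec.scale_right_distrib cvec.scale_left_distrib
  cvec.scale_right_diff_distrib cvec.scale_left_diff_distrib
  scaleC_mult_left scaleC_mult_right

lemma polarization:
  fixes B :: "'x::complex_vector \<Rightarrow> 'x \<Rightarrow> 'y::complex_vector"
  assumes "\<And>u v w. B (u + v) w = B u w + B v w" "\<And>u v w. B u (v + w) = B u v + B u w"
    and "\<And>c u v. B (c *\<^sub>C u) v = cnj c *\<^sub>C B u v" "\<And>c u v. B u (c *\<^sub>C v) = c *\<^sub>C B u v"
  defines "f \<equiv> \<lambda>u v c. B (v + c *\<^sub>C u) (v + c *\<^sub>C u)"
  shows "4 *\<^sub>C B u v = f u v 1 - f u v (-1) + (\<i> *\<^sub>C f u v \<i> - \<i> *\<^sub>C f u v (-\<i>))"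
proof -
  have four: "(4::complex) *\<^sub>C w = w + w + w + w" for w :: 'y
    using cvec.scale_left_distrib[of 1 1 w] cvec.scale_left_distrib[of 2 2 w] by simp
  have minus: "B (- u) w = - B u w" "B w (- u) = - B w u" for u w
    using assms(3)[of "-1" u w] assms(4)[of w "-1" u] by simp_all
  show ?thesis
    by (simp add: f_def four assms(1-4) minus algebra_simps scaleC_distribs scaleC_scaleC)
qed

lemma star_zero [simp]: "star (0 :: 'a::complex_star_algebra) = 0"
  using star_add[of "0::'a" 0] by simp

lemma star_minus: "star (- x) = - star (x :: 'a::complex_star_algebra)"
  using star_add[of x "- x"] by (simp add: add_eq_0_iff minus_equation_iff)

lemma star_diff: "star (x - y) = star x - star (y :: 'a::complex_star_algebra)"
  using star_add[of x "- y"] by (simp add: star_minus)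

lemma star_one [simp]: "star (1 :: 'a::{complex_star_algebra,ring_1}) = 1"
proof -
  have "star (1::'a) = star 1 * star (star 1)" by (simp add: star_star)
  also have "\<dots> = star (star 1 * 1)" by (simp only: star_mult)
  finally show ?thesis by (simp add: star_star)
qed

lemmas star_simps = star_star star_add star_diff star_minus star_scaleC star_mult

lemma star_power_selfadjoint:
  "star h = h \<Longrightarrow> star (h ^ n) = h ^ n" for h :: "'a::{complex_star_algebra,ring_1}"
  by (induction n) (simp_all add: star_mult power_commutes)

lemma seminormD:
  assumes "seminorm p"
  shows seminorm_nonneg: "0 \<le> p x" and seminorm_triangle: "p (x + y) \<le> p x + p y"
    and seminorm_scaleC: "p (c *\<^sub>C x) = cmod c * p x"
  using assms by (auto simp: seminorm_def)

lemma seminorm_zero: "seminorm p \<Longrightarrow> p 0 = 0"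
  using seminorm_scaleC[of p 0 0] by simp

lemma seminorm_minus: "seminorm p \<Longrightarrow> p (- x) = p x"
  using seminorm_scaleC[of p "-1" x] by simp

lemma seminorm_diff: "seminorm p \<Longrightarrow> p (x - y) \<le> p x + p y"
  using seminorm_triangle[of p x "- y"] by (simp add: seminorm_minus)

lemma seminorm_sum: "seminorm p \<Longrightarrow> p (sum f I) \<le> (\<Sum>i\<in>I. p (f i))"
proof (induction I rule: infinite_finite_induct)
  case (insert i I)
  then show ?case using seminorm_triangle[of p "f i" "sum f I"] by simp
qed (simp_all add: seminorm_zero)

lemma cstar_seminormD:
  assumes "cstar_seminorm p"
  shows cstar_seminorm_seminorm: "seminorm p" and cstar_seminorm_cstar: "p (star a * a) = (p a)\<^sup>2"
  using assms by (auto simp: cstar_seminorm_def)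

text \<open>
  Divide \<open>z\<close> by \<open>q z + \<delta>\<close> and let \<open>\<delta>\<close> tend to \<open>0\<close>; the \<open>\<delta>\<close> keeps the scaling meaningful when
  \<open>q z = 0\<close>.
\<close>

lemma bounded_by_homogeneity:
  fixes N q :: "'a::complex_vector \<Rightarrow> real"
  assumes N: "\<And>t z. t > 0 \<Longrightarrow> N (complex_of_real t *\<^sub>C z) = t * N z"
    and q: "\<And>t z. t > 0 \<Longrightarrow> q (complex_of_real t *\<^sub>C z) = t * q z"
    and q0: "\<And>z. 0 \<le> q z"
    and bound: "\<And>z. q z \<le> 1 \<Longrightarrow> N z \<le> K"
    and K: "0 \<le> K"
  shows "N z \<le> K * q z"
proof (rule field_le_epsilon)
  fix e :: real assume e: "e > 0"
  define m where "m = q z + e / (K + 1)"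
  have m: "m > 0" using e K q0[of z] by (auto simp: m_def intro!: add_nonneg_pos divide_pos_pos)
  have "q (complex_of_real (1/m) *\<^sub>C z) = (1/m) * q z" using q[of "1/m" z] m by simp
  also have "\<dots> \<le> 1" using m e K by (simp add: m_def)
  finally have "N (complex_of_real (1/m) *\<^sub>C z) \<le> K" by (rule bound)
  then have "N z \<le> K * m" using N[of "1/m" z] m by (simp add: pos_divide_le_eq)
  also have "\<dots> \<le> K * q z + e" using e K by (simp add: m_def field_simps)
  finally show "N z \<le> K * q z + e" .
qed

text \<open>
  A constant in front of a bound between powers is harmless: take roots of large order.  All the
  growth arguments below end here.
\<close>

lemma le_of_powers_bounded:
  fixes z d K :: real
  assumes d: "0 \<le> d" and bound: "\<And>m. \<exists>n\<ge>m. z ^ n \<le> K * d ^ n"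
  shows "z \<le> d"
proof (rule ccontr)
  assume "\<not> z \<le> d"
  then have zd: "d < z" by simp
  show False
  proof (cases "d = 0")
    case True
    obtain n where "n \<ge> 1" "z ^ n \<le> K * d ^ n" using bound by blast
    then show False using True zd by (simp add: zero_power) (meson zero_less_power not_less)
  next
    case False
    then have d0: "d > 0" using d by simp
    then have x: "z / d > 1" using zd by simp
    obtain m where m: "K < (z/d) ^ m" using real_arch_pow[OF x] by blast
    obtain n where n: "n \<ge> m" "z ^ n \<le> K * d ^ n" using bound by blast
    have "(z/d) ^ m \<le> (z/d) ^ n" using x n(1) by (intro power_increasing) auto
    also have "\<dots> \<le> K" using n(2) d0 by (simp add: power_divide divide_le_eq)
    finally show False using m by simp
  qed
qed


section \<open>Approximate square roots\<close>

locale submultiplicative_seminorm =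
  fixes L :: "'u::{complex_star_algebra,ring_1} \<Rightarrow> real"
  assumes seminorm_L: "seminorm L"
    and L_mult: "L (x * y) \<le> L x * L y"
    and L_one: "L 1 \<le> 1"
begin

lemmas L_nonneg [simp] = seminorm_nonneg[OF seminorm_L]
  and L_triangle = seminorm_triangle[OF seminorm_L]
  and L_scaleC = seminorm_scaleC[OF seminorm_L]
  and L_zero [simp] = seminorm_zero[OF seminorm_L]
  and L_minus = seminorm_minus[OF seminorm_L]
  and L_diff = seminorm_diff[OF seminorm_L]

lemma L_diff_commute: "L (x - y) = L (y - x)"
  using L_minus[of "x - y"] by simp

lemma L_power: "L (x ^ n) \<le> L x ^ n"
proof (induction n)
  case (Suc n)
  have "L (x * x ^ n) \<le> L x * L (x ^ n)" by (rule L_mult)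
  also have "\<dots> \<le> L x * L x ^ n" using Suc by (intro mult_left_mono) auto
  finally show ?case by simp
qed (simp add: L_one)

lemma L_scalar: "0 \<le> t \<Longrightarrow> L (complex_of_real t *\<^sub>C 1) \<le> t"
  using mult_left_mono[OF L_one, of t] by (simp add: L_scaleC)

text \<open>
  Polynomials \<open>q\<^sub>k\<close> in \<open>u\<close> with \<open>1 - q\<^sub>k \<rightarrow> \<surd>(1 - u)\<close>: the fixed points of the recursion satisfy
  \<open>(1 - q)\<^sup>2 = 1 - u\<close>.  All coefficients are nonnegative, also those of the increments
  \<open>q\<^sub>k\<^sub>+\<^sub>1 - q\<^sub>k\<close>, so both are dominated in norm by their values at \<open>u = 1\<close>.
\<close>

primrec newton :: "'u \<Rightarrow> nat \<Rightarrow> 'u" where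
  "newton u 0 = 0"
| "newton u (Suc k) = (1/2) *\<^sub>C (u + newton u k * newton u k)"

primrec newton_real :: "nat \<Rightarrow> real" where
  "newton_real 0 = 0"
| "newton_real (Suc k) = (1 + newton_real k * newton_real k) / 2"

lemma newton_commute: "v * u = u * v \<Longrightarrow> v * newton u k = newton u k * v"
proof (induction k)
  case (Suc k)
  have "v * (newton u k * newton u k) = (newton u k * newton u k) * v"
    using Suc by (metis mult.assoc)
  then show ?case using Suc.prems
    by (simp add: scaleC_mult_left scaleC_mult_right algebra_simps)
qed simp

lemma newton_selfadjoint: "star u = u \<Longrightarrow> star (newton u k) = newton u k"
  by (induction k) (simp_all add: star_simps)

lemma newton_real_bounds: "0 \<le> newton_real k \<and> newton_real k \<le> 1"
proof (induction k)
  case (Suc k)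
  then have "newton_real k * newton_real k \<le> 1 * 1" by (intro mult_mono) auto
  then show ?case using Suc by simp
qed simp

text \<open>
  The increments factor as \<open>q\<^sub>k\<^sub>+\<^sub>1 - q\<^sub>k = (q\<^sub>k - q\<^sub>k\<^sub>-\<^sub>1)(q\<^sub>k + q\<^sub>k\<^sub>-\<^sub>1)/2\<close>, since the \<open>q\<^sub>k\<close> commute; the real
  sequence satisfies the same identity.
\<close>

lemma L_newton:
  assumes "L u \<le> 1"
  shows "L (newton u k) \<le> newton_real k"
    and "L (newton u (Suc k) - newton u k) \<le> newton_real (Suc k) - newton_real k"
proof -
  show A: "L (newton u k) \<le> newton_real k" for k
  proof (induction k)
    case (Suc k)
    have "L (newton u (Suc k)) \<le> (L u + L (newton u k * newton u k)) / 2"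
      using L_triangle[of u "newton u k * newton u k"] by (simp add: L_scaleC)
    also have "\<dots> \<le> (1 + newton_real k * newton_real k) / 2"
    proof -
      have "L (newton u k * newton u k) \<le> newton_real k * newton_real k"
        by (rule order_trans[OF L_mult], intro mult_mono) (use Suc newton_real_bounds in auto)
      then show ?thesis using assms by simp
    qed
    finally show ?case by simp
  qed simp
  show "L (newton u (Suc k) - newton u k) \<le> newton_real (Suc k) - newton_real k"
  proof (induction k)
    case 0
    then show ?case using assms by (simp add: L_scaleC)
  next
    case (Suc k)
    let ?q = "newton u" and ?t = newton_real
    have c: "?q (Suc k) * ?q k = ?q k * ?q (Suc k)"
      by (intro newton_commute newton_commute[symmetric]) simp
    have "?q (Suc (Suc k)) - ?q (Suc k) =
        (1/2) *\<^sub>C (?q (Suc k) * ?q (Suc k) - ?q k * ?q k)"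
    proof -
      have "(1/2) *\<^sub>C (u + v) - (1/2) *\<^sub>C (u + w) = (1/2) *\<^sub>C (v - w)" for v w
        by (simp add: cvec.scale_right_diff_distrib[symmetric])
      then show ?thesis by (simp only: newton.simps(2)[of u "Suc k"] newton.simps(2)[of u k])
    qed
    also have "\<dots> = (1/2) *\<^sub>C ((?q (Suc k) - ?q k) * (?q (Suc k) + ?q k))"
      using c by (simp only: algebra_simps)
    finally have "L (?q (Suc (Suc k)) - ?q (Suc k)) =
        L ((?q (Suc k) - ?q k) * (?q (Suc k) + ?q k)) / 2"
      by (simp only: L_scaleC) simp
    also have "\<dots> \<le> ((?t (Suc k) - ?t k) * (?t (Suc k) + ?t k)) / 2"
    proof -
      have "L ((?q (Suc k) - ?q k) * (?q (Suc k) + ?q k))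
          \<le> L (?q (Suc k) - ?q k) * L (?q (Suc k) + ?q k)" by (rule L_mult)
      also have "\<dots> \<le> (?t (Suc k) - ?t k) * (?t (Suc k) + ?t k)"
        using Suc order_trans[OF L_nonneg Suc] L_triangle[of "?q (Suc k)" "?q k"] A[of k] A[of "Suc k"]
        by (intro mult_mono) (auto simp del: newton.simps newton_real.simps)
      finally show ?thesis by simp
    qed
    also have "\<dots> = ?t (Suc (Suc k)) - ?t (Suc k)"
      by (simp add: field_simps)
    finally show ?case .
  qed
qed

lemma newton_real_small_step:
  assumes "e > 0" shows "\<exists>k. newton_real (Suc k) - newton_real k \<le> e"
proof (rule ccontr)
  assume "\<not> ?thesis"
  then have step: "newton_real (Suc k) > newton_real k + e" for k
    by (auto simp: not_le algebra_simps simp del: newton_real.simps)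
  have "newton_real k \<ge> real k * e" for k
  proof (induction k)
    case (Suc k)
    then show ?case using step[of k] by (simp add: algebra_simps del: newton_real.simps)
  qed simp
  moreover obtain k where "real k * e > 1" using reals_Archimedean3[OF assms] by blast
  ultimately show False using newton_real_bounds[of k] by (meson not_less order_trans less_le_trans)
qed

text \<open>
  With \<open>r = 1 - q\<^sub>k\<close> the error \<open>1 - u - r\<^sup>2\<close> is \<open>2(q\<^sub>k - q\<^sub>k\<^sub>+\<^sub>1)\<close>.  It becomes small even at the boundary
  \<open>L u = 1\<close> of the disc of convergence.  As \<open>r\<close> is a polynomial in \<open>u\<close>, it commutes with whatever
  commutes with \<open>u\<close>; this is all that is recorded about its shape.
\<close>

lemma approx_sqrt:
  assumes "L u \<le> 1" "star u = u" "e > 0"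
  obtains r where "star r = r" "\<And>v. v * u = u * v \<Longrightarrow> v * r = r * v" "L (1 - u - r * r) \<le> e"
proof -
  obtain k where k: "newton_real (Suc k) - newton_real k \<le> e / 2"
    using newton_real_small_step[of "e/2"] assms(3) by auto
  let ?q = "newton u k"
  define r where "r = 1 - ?q"
  have "2 *\<^sub>C newton u (Suc k) = u + ?q * ?q" by simp
  then have "1 - u - r * r = 2 *\<^sub>C (?q - newton u (Suc k))"
    unfolding cvec.scale_right_diff_distrib r_def
    using cvec.scale_left_distrib[of 1 1 ?q] by (simp add: algebra_simps)
  then have "L (1 - u - r * r) = 2 * L (newton u (Suc k) - ?q)"
    by (metis L_scaleC L_diff_commute norm_numeral)
  then have "L (1 - u - r * r) \<le> e" using L_newton(2)[OF assms(1), of k] k by linarith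
  moreover have "star r = r" using newton_selfadjoint[OF assms(2)] by (simp add: r_def star_diff)
  moreover have "v * r = r * v" if "v * u = u * v" for v
    using newton_commute[OF that] by (simp add: r_def algebra_simps)
  ultimately show thesis using that by blast
qed

end

section \<open>Positive elements for a unital seminorm\<close>

locale unital_cstar_seminorm = submultiplicative_seminorm +
  assumes L_square_le_cstar: "(L a)\<^sup>2 \<le> L (star a * a)"
begin

lemma L_star: "L (star a) = L a"
proof -
  have le: "L b \<le> L (star b)" for b
  proof (cases "L b = 0")
    case False
    have "L b * L b \<le> L (star b) * L b"
      using L_mult[of "star b" b] L_square_le_cstar[of b] by (simp add: power2_eq_square)
    then show ?thesis using False L_nonneg[of b] by (simp add: less_le)
  qed simp
  show ?thesis using le[of a] le[of "star a"] by (simp add: star_star)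
qed

lemma L_cstar: "L (star a * a) = (L a)\<^sup>2"
  using L_mult[of "star a" a] L_square_le_cstar[of a] by (simp add: L_star power2_eq_square)

lemma L_square: "star h = h \<Longrightarrow> L (h * h) = (L h)\<^sup>2"
  using L_cstar[of h] by simp

text \<open>
  The \<open>C\<^sup>*\<close>-identity settles the exponents \<open>2\<^sup>k\<close>; for smaller ones, a strict inequality would be
  inherited by \<open>2\<^sup>k\<close> through submultiplicativity.
\<close>

lemma L_power_selfadjoint:
  assumes "star h = h" "n > 0" shows "L (h ^ n) = L h ^ n"
proof (rule antisym[OF L_power])
  have pow2: "L (h ^ 2 ^ k) = L h ^ 2 ^ k" for k
  proof (induction k)
    case (Suc k)
    have "h ^ 2 ^ Suc k = h ^ 2 ^ k * h ^ 2 ^ k" by (simp add: power_add[symmetric] mult_2)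
    then have "L (h ^ 2 ^ Suc k) = (L (h ^ 2 ^ k))\<^sup>2"
      by (simp add: L_square star_power_selfadjoint assms(1))
    then show ?case using Suc by (simp add: power_mult[symmetric] mult.commute)
  qed simp
  show "L h ^ n \<le> L (h ^ n)"
  proof (cases "L h = 0")
    case False
    then have h: "L h > 0" by (simp add: less_le)
    define m where "m = 2 ^ n - n"
    have nm: "2 ^ n = n + m" unfolding m_def using less_exp[of n] by simp
    have "L h ^ n * L h ^ m = L (h ^ n * h ^ m)" using pow2[of n] nm by (simp add: power_add)
    also have "\<dots> \<le> L (h ^ n) * L (h ^ m)" by (rule L_mult)
    also have "\<dots> \<le> L (h ^ n) * L h ^ m" by (intro mult_left_mono L_power) simp
    finally show ?thesis using h by simp
  qed (use assms(2) in \<open>simp add: zero_power\<close>)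
qed

text \<open>
  Here \<open>h\<^sup>2 + k\<^sup>2 = c\<^sup>*c\<close> for the normal element \<open>c = h + ik\<close>, and \<open>h\<close> is the real part of \<open>c\<close>.
\<close>

lemma L_square_le_add:
  assumes "star h = h" "star k = k" "h * k = k * h"
  shows "L (h * h) \<le> L (h * h + k * k)"
proof -
  define c where "c = h + \<i> *\<^sub>C k"
  have sc: "star c = h - \<i> *\<^sub>C k" using assms by (simp add: c_def star_simps)
  have "star c * c = h * h + k * k"
    unfolding sc unfolding c_def using assms(3)
    by (simp add: algebra_simps scaleC_mult_left scaleC_mult_right scaleC_scaleC)
  then have c: "(L c)\<^sup>2 = L (h * h + k * k)" using L_cstar[of c] by simp
  have "2 *\<^sub>C h = c + star c" unfolding sc unfolding c_def
    using cvec.scale_left_distrib[of 1 1 h] by simp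
  then have "2 * L h \<le> 2 * L c" using L_triangle[of c "star c"]
    by (metis L_scaleC L_star mult_2 norm_numeral)
  then have "(L h)\<^sup>2 \<le> (L c)\<^sup>2" by (intro power_mono) auto
  then show ?thesis using c assms(1) by (simp add: L_square)
qed

text \<open>
  In a \<open>C\<^sup>*\<close>-algebra a self-adjoint \<open>s\<close> has nonnegative spectrum iff \<open>\<parallel>t - s\<parallel> \<le> t\<close> for some
  \<open>t \<ge> 0\<close>; this description makes sense without a spectrum.
\<close>

definition pos :: "'a \<Rightarrow> bool" where
  "pos s \<longleftrightarrow> star s = s \<and> (\<exists>t\<ge>0. L (complex_of_real t *\<^sub>C 1 - s) \<le> t)"

lemma pos_selfadjoint: "pos s \<Longrightarrow> star s = s"
  by (simp add: pos_def)

lemma L_shift_le: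
  assumes "L (complex_of_real t *\<^sub>C 1 - s) \<le> t + d" "t \<le> t'"
  shows "L (complex_of_real t' *\<^sub>C 1 - s) \<le> t' + d"
proof -
  have "complex_of_real t' *\<^sub>C 1 - s = complex_of_real (t' - t) *\<^sub>C 1 + (complex_of_real t *\<^sub>C 1 - s)"
    by (simp add: cvec.scale_left_diff_distrib)
  then have "L (complex_of_real t' *\<^sub>C 1 - s) \<le> L (complex_of_real (t' - t) *\<^sub>C 1) + (t + d)"
    using L_triangle assms(1) by (metis add_left_mono order_trans)
  then show ?thesis using L_scalar[of "t' - t"] assms(2) by simp
qed

lemma posE:
  assumes "pos s"
  obtains t where "t \<ge> m" "t > 0" "L (complex_of_real t *\<^sub>C 1 - s) \<le> t"
proof -
  obtain t where t: "t \<ge> 0" "L (complex_of_real t *\<^sub>C 1 - s) \<le> t"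
    using assms by (auto simp: pos_def)
  show thesis
    by (rule that[of "max 1 (max m t)"]) (use L_shift_le[of t s 0 "max 1 (max m t)"] t in auto)
qed

lemma pos_scalar_diff:
  assumes "star s = s" "L s \<le> t" shows "pos (complex_of_real t *\<^sub>C 1 - s)"
proof -
  have "0 \<le> t" using assms(2) L_nonneg[of s] by linarith
  then show ?thesis using assms unfolding pos_def
    by (intro conjI exI[of _ t]) (auto simp: star_simps)
qed

lemma pos_one_diff: "star s = s \<Longrightarrow> L s \<le> 1 \<Longrightarrow> pos (1 - s)"
  using pos_scalar_diff[of s 1] by simp

lemma pos_zero: "pos 0"
  by (auto simp: pos_def intro!: exI[of _ "0::real"])

lemma pos_add:
  assumes "pos s" "pos s'" shows "pos (s + s')"
proof -
  obtain t t' where t: "t > 0" "L (complex_of_real t *\<^sub>C 1 - s) \<le> t"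
    and t': "t' > 0" "L (complex_of_real t' *\<^sub>C 1 - s') \<le> t'"
    using posE assms by metis
  have "complex_of_real (t + t') *\<^sub>C 1 - (s + s')
      = (complex_of_real t *\<^sub>C 1 - s) + (complex_of_real t' *\<^sub>C 1 - s')"
    by (simp add: cvec.scale_left_distrib)
  then have "L (complex_of_real (t + t') *\<^sub>C 1 - (s + s')) \<le> t + t'"
    using L_triangle t(2) t'(2) by (metis add_mono order_trans)
  then show ?thesis using assms t t' unfolding pos_def
    by (intro conjI exI[of _ "t + t'"]) (auto simp: star_add)
qed

lemma pos_scale:
  assumes "pos s" "r \<ge> 0" shows "pos (complex_of_real r *\<^sub>C s)"
proof -
  obtain t where t: "t > 0" "L (complex_of_real t *\<^sub>C 1 - s) \<le> t"
    using posE assms(1) by metis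
  have "complex_of_real (r * t) *\<^sub>C 1 - complex_of_real r *\<^sub>C s = complex_of_real r *\<^sub>C (complex_of_real t *\<^sub>C 1 - s)"
    by (simp add: cvec.scale_right_diff_distrib)
  then have "L (complex_of_real (r * t) *\<^sub>C 1 - complex_of_real r *\<^sub>C s) \<le> r * t"
    using t(2) assms(2) by (simp add: L_scaleC mult_left_mono)
  then show ?thesis using assms t unfolding pos_def
    by (intro conjI exI[of _ "r * t"]) (auto simp: star_scaleC)
qed

lemma pos_approx_square:
  assumes "pos s" "e > 0"
  obtains r where "star r = r" "\<And>v. v * s = s * v \<Longrightarrow> v * r = r * v" "L (s - r * r) \<le> e"
proof -
  obtain t where t: "t > 0" "L (complex_of_real t *\<^sub>C 1 - s) \<le> t"
    using posE assms(1) by metis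
  define u where "u = 1 - complex_of_real (1 / t) *\<^sub>C s"
  have tu: "complex_of_real t *\<^sub>C u = complex_of_real t *\<^sub>C 1 - s"
    using t(1) by (simp add: u_def cvec.scale_right_diff_distrib)
  have "t * L u = L (complex_of_real t *\<^sub>C u)" using t(1) by (simp add: L_scaleC)
  then have "t * L u \<le> t * 1" using t by (simp add: tu)
  then have Lu: "L u \<le> 1" using t(1) by simp
  have su: "star u = u" using pos_selfadjoint[OF assms(1)] by (simp add: u_def star_simps)
  obtain r where r: "star r = r" "\<And>v. v * u = u * v \<Longrightarrow> v * r = r * v" "L (1 - u - r * r) \<le> e / t"
    using approx_sqrt[OF Lu su divide_pos_pos[OF assms(2) t(1)]] by blast
  define r' where "r' = complex_of_real (sqrt t) *\<^sub>C r"
  have "r' * r' = complex_of_real t *\<^sub>C (r * r)"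
    using t(1) by (simp add: r'_def scaleC_mult_left scaleC_mult_right of_real_mult[symmetric] del: of_real_mult)
  then have "s - r' * r' = complex_of_real t *\<^sub>C (1 - u - r * r)"
    using tu by (simp add: cvec.scale_right_diff_distrib)
  then have "L (s - r' * r') = t * L (1 - u - r * r)" using t(1) by (simp add: L_scaleC)
  then have "L (s - r' * r') \<le> e" using r(3) t(1) by (simp add: pos_le_divide_eq mult.commute)
  moreover have "star r' = r'" using r(1) by (simp add: r'_def star_simps)
  moreover have "v * r' = r' * v" if "v * s = s * v" for v
  proof -
    have "v * u = u * v" using that by (simp add: u_def algebra_simps scaleC_mult_left scaleC_mult_right)
    then have "v * r = r * v" by (rule r(2))
    then show ?thesis by (simp add: r'_def scaleC_mult_left scaleC_mult_right)
  qed
  ultimately show thesis using that by blast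
qed

text \<open>
  The norm of \<open>1 - h\<^sup>2 \<approx> r\<^sup>2\<close> is controlled because \<open>h\<^sup>2 + r\<^sup>2 \<approx> 1\<close> with \<open>h\<close> and \<open>r\<close> commuting.
\<close>

lemma L_one_diff_square:
  assumes "star h = h" "L (h * h) \<le> 1" shows "L (1 - h * h) \<le> 1"
proof (rule field_le_epsilon)
  fix e :: real assume e: "e > 0"
  have "star (h * h) = h * h" using assms(1) by (simp add: star_mult)
  then obtain r where r: "star r = r" "\<And>v. v * (h * h) = h * h * v \<Longrightarrow> v * r = r * v"
      "L (1 - h * h - r * r) \<le> e / 2"
    using approx_sqrt[OF assms(2) _ half_gt_zero[OF e]] by blast
  have "h * r = r * h" using r(2)[of h] by (simp add: mult.assoc)
  then have "L (r * r) \<le> L (r * r + h * h)" by (intro L_square_le_add assms(1) r(1)) simp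
  also have "r * r + h * h = 1 - (1 - h * h - r * r)" by simp
  also have "L \<dots> \<le> 1 + e / 2" using L_diff[of 1 "1 - h * h - r * r"] L_one r(3) by linarith
  finally have "L (r * r) \<le> 1 + e / 2" .
  moreover have "1 - h * h = r * r + (1 - h * h - r * r)" by simp
  then have "L (1 - h * h) \<le> L (r * r) + L (1 - h * h - r * r)" by (metis L_triangle)
  ultimately show "L (1 - h * h) \<le> 1 + e" using r(3) by linarith
qed

text \<open>
  The converse of \<open>pos_approx_square\<close>.  It makes squares positive and reduces the product of
  commuting positive elements to \<open>h\<^sup>2 k\<^sup>2 = (hk)\<^sup>2\<close>.
\<close>

lemma pos_of_approx_square:
  assumes s: "star s = s" and ap: "\<And>e. e > 0 \<Longrightarrow> \<exists>h. star h = h \<and> L (s - h * h) \<le> e"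
  shows "pos s"
proof -
  have "L (complex_of_real (L s) *\<^sub>C 1 - s) \<le> L s"
  proof (rule field_le_epsilon)
    fix e :: real assume e: "e > 0"
    define d where "d = e / 3"
    have d: "d > 0" using e by (simp add: d_def)
    obtain h where h: "star h = h" "L (s - h * h) \<le> d" using ap d by blast
    define t where "t = L s + d"
    have t: "t > 0" using d L_nonneg[of s] by (simp add: t_def add_nonneg_pos)
    have hh: "L (h * h) \<le> t"
      using L_triangle[of s "h * h - s"] L_diff_commute[of s "h * h"] h(2) by (simp add: t_def)
    define k where "k = complex_of_real (1 / sqrt t) *\<^sub>C h"
    have kk: "k * k = complex_of_real (1 / t) *\<^sub>C (h * h)"
      using t by (simp add: k_def scaleC_mult_left scaleC_mult_right of_real_mult[symmetric] del: of_real_mult)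
    have "L (1 - k * k) \<le> 1"
    proof (rule L_one_diff_square)
      show "star k = k" using h(1) by (simp add: k_def star_simps)
      show "L (k * k) \<le> 1" unfolding kk using t hh by (simp add: L_scaleC norm_divide)
    qed
    moreover have "complex_of_real t *\<^sub>C 1 - h * h = complex_of_real t *\<^sub>C (1 - k * k)"
      using t by (simp add: kk cvec.scale_right_diff_distrib)
    ultimately have 1: "L (complex_of_real t *\<^sub>C 1 - h * h) \<le> t" using t by (simp add: L_scaleC)
    have "complex_of_real (L s) *\<^sub>C 1 - s
        = (complex_of_real t *\<^sub>C 1 - h * h) - complex_of_real d *\<^sub>C 1 - (s - h * h)"
      by (simp add: t_def cvec.scale_left_distrib)
    then have "L (complex_of_real (L s) *\<^sub>C 1 - s) \<le> t + d + d"
      using L_diff[of "complex_of_real t *\<^sub>C 1 - h * h - complex_of_real d *\<^sub>C 1" "s - h * h"]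
        L_diff[of "complex_of_real t *\<^sub>C 1 - h * h" "complex_of_real d *\<^sub>C 1"]
        L_scalar[of d] 1 h(2) d by simp
    then show "L (complex_of_real (L s) *\<^sub>C 1 - s) \<le> L s + e" by (simp add: t_def d_def)
  qed
  then show ?thesis using s unfolding pos_def by (intro conjI exI[of _ "L s"]) auto
qed

lemma pos_square:
  assumes "star h = h" shows "pos (h * h)"
proof (rule pos_of_approx_square)
  show "\<exists>k. star k = k \<and> L (h * h - k * k) \<le> e" if "e > 0" for e
    using assms that by (intro exI[of _ h]) simp
qed (simp add: assms star_mult)

lemma pos_mult_commuting:
  assumes s: "pos s" and t: "pos t" and comm: "s * t = t * s"
  shows "pos (s * t)"
proof (rule pos_of_approx_square)
  show "star (s * t) = s * t" using assms by (simp add: star_mult pos_selfadjoint)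
  fix e :: real assume e: "e > 0"
  define d where "d = min 1 (e / (L t + L s + 1))"
  have den: "L t + L s + 1 > 0" by (simp add: add_nonneg_pos)
  have d: "d > 0" "d \<le> 1" using e den by (auto simp: d_def)
  obtain h where h: "star h = h" "\<And>v. v * s = s * v \<Longrightarrow> v * h = h * v" "L (s - h * h) \<le> d"
    using pos_approx_square[OF s d(1)] by metis
  obtain k where k: "star k = k" "\<And>v. v * t = t * v \<Longrightarrow> v * k = k * v" "L (t - k * k) \<le> d"
    using pos_approx_square[OF t d(1)] by metis
  have "t * h = h * t" by (rule h(2)) (simp add: comm)
  then have hk: "h * k = k * h" by (intro k(2)) simp
  have hh: "L (h * h) \<le> L s + 1"
    using L_triangle[of s "h * h - s"] L_diff_commute[of s "h * h"] h(3) d(2) by simp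
  have "(h * k) * (h * k) = h * h * (k * k)" using hk by (metis mult.assoc)
  then have "s * t - (h * k) * (h * k) = (s - h * h) * t + h * h * (t - k * k)"
    by (simp add: algebra_simps)
  then have "L (s * t - (h * k) * (h * k)) \<le> L ((s - h * h) * t) + L (h * h * (t - k * k))"
    by (metis L_triangle)
  also have "\<dots> \<le> d * L t + (L s + 1) * d"
    by (rule add_mono; rule order_trans[OF L_mult], rule mult_mono)
      (use h(3) k(3) hh d(1) in auto)
  also have "\<dots> = d * (L t + L s + 1)" by (simp add: algebra_simps)
  also have "\<dots> \<le> e" using den by (simp add: d_def min_mult_distrib_right)
  finally have "L (s * t - (h * k) * (h * k)) \<le> e" .
  moreover have "star (h * k) = h * k" using h(1) k(1) hk by (simp add: star_mult)
  ultimately show "\<exists>h. star h = h \<and> L (s * t - h * h) \<le> e" by blast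
qed

lemma pos_power: "pos y \<Longrightarrow> pos (y ^ n)"
proof (induction n)
  case 0
  then show ?case using pos_square[of 1] by simp
next
  case (Suc n)
  then show ?case using pos_mult_commuting[of y "y ^ n"] by (simp add: power_commutes)
qed

text \<open>
  If \<open>s \<approx> h\<^sup>2\<close> and \<open>m - s \<approx> k\<^sup>2\<close>, then \<open>h\<close> and \<open>k\<close> commute and \<open>h\<^sup>2 + k\<^sup>2 \<approx> m\<close>, so the norm of
  \<open>h\<^sup>2\<close> is at most \<open>m\<close> up to the error.
\<close>

lemma L_le_of_pos:
  assumes s: "pos s" and sm: "pos (complex_of_real m *\<^sub>C 1 - s)" and m: "0 \<le> m"
  shows "L s \<le> m"
proof (rule field_le_epsilon)
  fix e :: real assume e: "e > 0"
  define d where "d = e / 3"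
  have d: "d > 0" using e by (simp add: d_def)
  obtain h where h: "star h = h" "\<And>v. v * s = s * v \<Longrightarrow> v * h = h * v" "L (s - h * h) \<le> d"
    using pos_approx_square[OF s d] by metis
  let ?t = "complex_of_real m *\<^sub>C 1 - s"
  obtain k where k: "star k = k" "\<And>v. v * ?t = ?t * v \<Longrightarrow> v * k = k * v" "L (?t - k * k) \<le> d"
    using pos_approx_square[OF sm d] by metis
  have "s * h = h * s" by (rule h(2)) simp
  then have hk: "h * k = k * h"
    by (intro k(2)) (simp add: algebra_simps scaleC_mult_left scaleC_mult_right)
  have "h * h + k * k = complex_of_real m *\<^sub>C 1 - (s - h * h) - (?t - k * k)" by simp
  then have "L (h * h + k * k) \<le> m + d + d"
    using L_diff[of "complex_of_real m *\<^sub>C 1 - (s - h * h)" "?t - k * k"]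
        L_diff[of "complex_of_real m *\<^sub>C 1" "s - h * h"] L_scalar[OF m] h(3) k(3) by simp
  then have "L (h * h) \<le> m + d + d" using L_square_le_add[OF h(1) k(1) hk] by simp
  then show "L s \<le> m + e" using L_triangle[of "s - h * h" "h * h"] h(3) by (simp add: d_def)
qed

text \<open>
  With \<open>\<parallel>\<cdot>\<parallel>\<close> for \<open>L\<close>, \<open>\<parallel>s + t\<parallel> - s\<close> is the sum of the positive elements \<open>\<parallel>s + t\<parallel> - (s + t)\<close> and \<open>t\<close>; in this way the
  noncommuting \<open>s\<close> and \<open>t\<close> are reduced to the commuting pair \<open>s\<close>, \<open>\<parallel>s + t\<parallel> - s\<close>.
\<close>

lemma L_mono:
  assumes "pos s" "pos t" shows "L s \<le> L (s + t)"
proof (rule L_le_of_pos[OF assms(1)])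
  have "pos (complex_of_real (L (s + t)) *\<^sub>C 1 - (s + t) + t)"
    by (intro pos_add pos_scalar_diff assms) (simp_all add: star_add assms pos_selfadjoint)
  then show "pos (complex_of_real (L (s + t)) *\<^sub>C 1 - s)" by (simp add: algebra_simps)
qed simp

lemma L_le_one_of_pos:
  assumes "pos (1 - d)" "pos (1 + d)" shows "L d \<le> 1"
proof -
  have d: "star d = d" using pos_selfadjoint[OF assms(2)] by (simp add: star_add)
  have "pos ((1 - d) * (1 + d))" by (intro pos_mult_commuting assms) (simp add: algebra_simps)
  then have "pos (1 - d * d)" by (simp add: algebra_simps)
  then have "L (d * d) \<le> 1" using L_le_of_pos[OF pos_square[OF d], of 1] by simp
  then show ?thesis using d L_nonneg[of d] by (simp add: L_square abs_square_le_1)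
qed

section \<open>Positivity of \<open>a\<^sup>*a\<close>\<close>

text \<open>
  This stands for the equality of the spectra of \<open>c\<^sup>*c\<close> and \<open>cc\<^sup>*\<close> outside \<open>0\<close>.  With
  \<open>f = \<sigma> + c\<^sup>*c\<close> and \<open>g = \<sigma> + cc\<^sup>*\<close> one has \<open>g\<^sup>n c = c f\<^sup>n\<close>, so the powers of \<open>g\<close> grow no faster
  than those of \<open>f\<close>; and as \<open>g\<close> is self-adjoint, the growth of its powers is its norm.
\<close>

lemma pos_one_diff_swap:
  assumes "pos (1 - star c * c)" shows "pos (1 - c * star c)"
proof -
  obtain t where t: "t \<ge> 1" "L (complex_of_real t *\<^sub>C 1 - (1 - star c * c)) \<le> t"
    using posE[OF assms] by metis
  define \<sigma> where "\<sigma> = t - 1"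
  define f where "f = complex_of_real \<sigma> *\<^sub>C 1 + star c * c"
  define g where "g = complex_of_real \<sigma> *\<^sub>C 1 + c * star c"
  have \<sigma>: "\<sigma> \<ge> 0" using t by (simp add: \<sigma>_def)
  have f: "L f \<le> \<sigma> + 1"
    using t(2) by (simp add: f_def \<sigma>_def cvec.scale_left_diff_distrib algebra_simps)
  have g: "star g = g" by (simp add: g_def star_simps)
  have gc: "g ^ n * c = c * f ^ n" for n
  proof (induction n)
    case (Suc n)
    have "g ^ Suc n * c = g * (c * f ^ n)" using Suc by (simp add: mult.assoc)
    also have "\<dots> = c * (f * f ^ n)"
      by (simp add: f_def g_def scaleC_mult_left scaleC_mult_right algebra_simps)
    finally show ?case by simp
  qed simp
  have bound: "L g ^ Suc n \<le> \<sigma> * L g ^ n + L c * L c * (\<sigma> + 1) ^ n" if "n > 0" for n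
  proof -
    have "g ^ Suc n = complex_of_real \<sigma> *\<^sub>C g ^ n + c * f ^ n * star c"
    proof -
      have "g ^ Suc n = g ^ n * g" by (simp add: power_commutes)
      also have "\<dots> = complex_of_real \<sigma> *\<^sub>C g ^ n + (g ^ n * c) * star c"
        by (simp add: g_def scaleC_mult_right distrib_left mult.assoc)
      finally show ?thesis by (simp add: gc)
    qed
    then have "L g ^ Suc n \<le> L (complex_of_real \<sigma> *\<^sub>C g ^ n) + L (c * f ^ n * star c)"
      using L_triangle L_power_selfadjoint[OF g, of "Suc n"] by (metis zero_less_Suc)
    also have "L (complex_of_real \<sigma> *\<^sub>C g ^ n) = \<sigma> * L g ^ n"
      using \<sigma> L_power_selfadjoint[OF g that] by (simp add: L_scaleC)
    also have "L (c * f ^ n * star c) \<le> L c * (\<sigma> + 1) ^ n * L c"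
    proof -
      have "L (c * f ^ n * star c) \<le> L c * L (f ^ n) * L c"
        by (rule order_trans[OF L_mult]) (simp add: L_star mult_right_mono L_mult)
      also have "L (f ^ n) \<le> (\<sigma> + 1) ^ n"
        by (rule order_trans[OF L_power]) (simp add: power_mono f)
      finally show ?thesis by (simp add: mult_left_mono mult_right_mono)
    qed
    finally show ?thesis by (simp add: algebra_simps)
  qed
  have "L g \<le> \<sigma> + 1"
  proof (rule ccontr)
    assume "\<not> L g \<le> \<sigma> + 1"
    then have gt: "L g - \<sigma> > 0" by simp
    have "L g \<le> \<sigma> + 1"
    proof (rule le_of_powers_bounded[where K = "L c * L c / (L g - \<sigma>)"])
      fix m
      have "L g ^ Suc m * (L g - \<sigma>) \<le> L c * L c * (\<sigma> + 1) ^ Suc m"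
        using bound[of "Suc m"] by (simp add: algebra_simps)
      then have "L g ^ Suc m \<le> L c * L c / (L g - \<sigma>) * (\<sigma> + 1) ^ Suc m"
        using gt by (simp add: field_simps)
      then show "\<exists>n\<ge>m. L g ^ n \<le> L c * L c / (L g - \<sigma>) * (\<sigma> + 1) ^ n"
        by (intro exI[of _ "Suc m"]) auto
    qed (use \<sigma> in simp)
    with \<open>\<not> L g \<le> \<sigma> + 1\<close> show False by simp
  qed
  then have "L (complex_of_real t *\<^sub>C 1 - (1 - c * star c)) \<le> t"
    by (simp add: g_def \<sigma>_def cvec.scale_left_diff_distrib algebra_simps)
  then show ?thesis using t(1) unfolding pos_def by (intro conjI exI[of _ t]) (auto simp: star_simps)
qed

text \<open>
  Up to a factor this is the sum of the squares of the real and imaginary parts of \<open>c\<close>.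
\<close>

lemma pos_star_mult_add: "pos (star c * c + c * star c)"
proof -
  define h where "h = c + star c"
  define k where "k = \<i> *\<^sub>C (c - star c)"
  have "star h = h" "star k = k"
    by (simp_all add: h_def k_def star_simps cvec.scale_right_diff_distrib)
  then have "pos (complex_of_real (1/2) *\<^sub>C (h * h + k * k))" by (intro pos_scale pos_add pos_square) auto
  also have "h * h + k * k = 2 *\<^sub>C (star c * c + c * star c)"
    using cvec.scale_left_distrib[of 1 1 "star c * c + c * star c"]
    by (simp add: h_def k_def scaleC_mult_left scaleC_mult_right scaleC_scaleC algebra_simps)
  finally show ?thesis by simp
qed

text \<open>
  With \<open>y = 1 - a\<^sup>*a\<close> the claim is \<open>L y \<le> 1\<close>.  For \<open>c = a y\<^sup>N\<close> the element
  \<open>c\<^sup>*c = (1 - y) y\<^sup>2\<^sup>N\<close> is bounded above by \<open>1\<close> for every \<open>N\<close>, hence so is \<open>cc\<^sup>*\<close>; since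
  \<open>c\<^sup>*c + cc\<^sup>*\<close> is positive, \<open>c\<^sup>*c\<close> is also bounded below by \<open>-1\<close>.  So the norms of
  \<open>y\<^sup>2\<^sup>N - y\<^sup>2\<^sup>N\<^sup>+\<^sup>1\<close> stay bounded, which excludes \<open>L y > 1\<close>: a part of \<open>a\<^sup>*a\<close> below \<open>0\<close> would make
  them grow exponentially.
\<close>

lemma pos_star_mult_of_le_one:
  assumes a: "L (star a * a) \<le> 1" shows "pos (star a * a)"
proof -
  define s where "s = star a * a"
  define y where "y = 1 - s"
  have s: "star s = s" by (simp add: s_def star_simps)
  have y: "star y = y" using s by (simp add: y_def star_simps)
  have posy: "pos y" unfolding y_def using s a by (intro pos_one_diff) (simp_all add: s_def)
  \<comment> \<open>The differences \<open>y\<^sup>j - y\<^sup>j\<^sup>+\<^sup>1\<close> decrease with \<open>j\<close>, because \<open>y\<^sup>j (1 - y)\<^sup>2\<close> is positive.\<close>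
  have upper: "pos (1 - y ^ j + y ^ Suc j)" for j
  proof (induction j)
    case (Suc j)
    have "pos (y ^ j * (s * s))"
    proof (rule pos_mult_commuting[OF pos_power[OF posy] pos_square[OF s]])
      have "y * (s * s) = (s * s) * y" by (simp add: y_def algebra_simps)
      then show "y ^ j * (s * s) = s * s * y ^ j" by (rule power_commuting_commutes)
    qed
    then have "pos (1 - y ^ j + y ^ Suc j + y ^ j * (s * s))" by (rule pos_add[OF Suc])
    also have "s * s = 1 - y - y + y\<^sup>2" by (simp add: y_def algebra_simps power2_eq_square)
    also have "y ^ j * (1 - y - y + y\<^sup>2) = y ^ j - y ^ Suc j - y ^ Suc j + y ^ Suc (Suc j)"
      by (simp add: distrib_left right_diff_distrib power_commutes power_add[symmetric])
    finally show ?case by (simp add: algebra_simps)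
  qed (use posy in simp)
  have small: "L (y ^ (2 * N) - y ^ Suc (2 * N)) \<le> 1" for N
  proof (rule L_le_one_of_pos)
    define c where "c = a * y ^ N"
    have "star c * c = y ^ N * (1 - y) * y ^ N"
      by (simp add: c_def star_mult star_power_selfadjoint[OF y] mult.assoc) (simp add: y_def s_def mult.assoc)
    also have "\<dots> = y ^ N * y ^ N - y * (y ^ N * y ^ N)"
      by (simp add: left_diff_distrib right_diff_distrib mult.assoc[symmetric] power_commutes)
    also have "\<dots> = y ^ (2 * N) - y ^ Suc (2 * N)"
      by (simp add: mult_2 power_add)
    finally have cc: "star c * c = y ^ (2 * N) - y ^ Suc (2 * N)" .
    show up: "pos (1 - (y ^ (2 * N) - y ^ Suc (2 * N)))" using upper[of "2 * N"] by (simp add: algebra_simps)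
    \<comment> \<open>The lower bound: \<open>1 + c\<^sup>*c = (1 - cc\<^sup>*) + (c\<^sup>*c + cc\<^sup>*)\<close>.\<close>
    then have "pos (1 - c * star c)" by (intro pos_one_diff_swap) (simp only: cc)
    then have "pos ((1 - c * star c) + (star c * c + c * star c))" by (intro pos_add pos_star_mult_add)
    then show "pos (1 + (y ^ (2 * N) - y ^ Suc (2 * N)))" by (simp add: cc)
  qed
  have "L y \<le> 1"
  proof (rule ccontr)
    assume "\<not> L y \<le> 1"
    then have gt: "L y - 1 > 0" by simp
    have "L y \<le> 1"
    proof (rule le_of_powers_bounded[where K = "1 / (L y - 1)"])
      fix m
      let ?n = "2 * Suc m"
      have "L y ^ Suc ?n = L (y ^ ?n - (y ^ ?n - y ^ Suc ?n))"
        using L_power_selfadjoint[OF y, of "Suc ?n"] by simp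
      also have "\<dots> \<le> L y ^ ?n + 1"
        using L_diff[of "y ^ ?n" "y ^ ?n - y ^ Suc ?n"] small[of "Suc m"] L_power[of y ?n]
        by linarith
      finally have "L y ^ ?n * (L y - 1) \<le> 1" by (simp add: algebra_simps)
      then have "L y ^ ?n \<le> 1 / (L y - 1) * 1 ^ ?n" using gt by (simp add: pos_le_divide_eq)
      then show "\<exists>n\<ge>m. L y ^ n \<le> 1 / (L y - 1) * 1 ^ n" by (intro exI[of _ ?n]) simp
    qed simp
    with \<open>\<not> L y \<le> 1\<close> show False by simp
  qed
  then show ?thesis using s unfolding pos_def s_def y_def by (intro conjI exI[of _ 1]) auto
qed

lemma pos_star_mult: "pos (star a * a)"
proof -
  define t where "t = L a + 1"
  have t: "t > 0" unfolding t_def using L_nonneg[of a] by linarith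
  define b where "b = complex_of_real (1 / t) *\<^sub>C a"
  have "L b \<le> 1" using t unfolding b_def L_scaleC using t by (simp add: norm_divide t_def del: of_real_add)
  then have "L (star b * b) \<le> 1" by (simp add: L_cstar power_le_one)
  then have "pos (complex_of_real (t * t) *\<^sub>C (star b * b))"
    using t by (intro pos_scale pos_star_mult_of_le_one) auto
  also have "complex_of_real (t * t) *\<^sub>C (star b * b) = star a * a"
    using t by (simp add: b_def star_simps scaleC_mult_left scaleC_mult_right)
  finally show ?thesis .
qed

end

section \<open>Unitization, submultiplicativity and monotonicity\<close>

datatype 'a unitization = Unitize (scalar: complex) (element: 'a)

instantiation unitization :: (complex_star_algebra) "{complex_star_algebra,ring_1}"
begin

definition "0 = Unitize 0 0"
definition "1 = Unitize 1 0"
definition "c + d = Unitize (scalar c + scalar d) (element c + element d)"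
definition "c - d = Unitize (scalar c - scalar d) (element c - element d)"
definition "- c = Unitize (- scalar c) (- element c)"
definition "c * d = Unitize (scalar c * scalar d)
  (scalar c *\<^sub>C element d + scalar d *\<^sub>C element c + element c * element d)"
definition "z *\<^sub>C c = Unitize (z * scalar c) (z *\<^sub>C element c)"
definition "star c = Unitize (cnj (scalar c)) (star (element c))"

instance
  by standard
    (simp_all add: zero_unitization_def one_unitization_def plus_unitization_def
      minus_unitization_def uminus_unitization_def times_unitization_def scaleC_unitization_def
      star_unitization_def algebra_simps scaleC_distribs star_simps unitization.expand)

end

lemmas unitization_defs = zero_unitization_def one_unitization_def plus_unitization_def
  minus_unitization_def uminus_unitization_def times_unitization_def scaleC_unitization_def
  star_unitization_def

abbreviation incl :: "'a \<Rightarrow> 'a::complex_star_algebra unitization" where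
  "incl \<equiv> Unitize 0"

lemma incl_simps:
  "incl (a + b) = incl a + incl b" "incl (a * b) = incl a * incl b"
  "incl (star a) = star (incl a)" "incl (z *\<^sub>C a) = z *\<^sub>C incl a" "incl 0 = 0"
  by (simp_all add: unitization_defs)

definition left_mult :: "'a unitization \<Rightarrow> 'a \<Rightarrow> 'a::complex_star_algebra" where
  "left_mult c x = scalar c *\<^sub>C x + element c * x"

text \<open>
  The original algebra is an ideal of its unitization, so \<open>left_mult c x\<close> is the product \<open>c x\<close>; the
  identity turns statements about it into associativity.
\<close>

lemma incl_left_mult: "incl (left_mult c x) = c * incl x"
  by (simp add: left_mult_def unitization_defs)

lemma left_mult_simps:
  "left_mult (c + d) x = left_mult c x + left_mult d x"
  "left_mult (c * d) x = left_mult c (left_mult d x)"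
  "left_mult (z *\<^sub>C c) x = z *\<^sub>C left_mult c x"
  "left_mult (incl a) x = a * x" "left_mult 1 x = x"
  "left_mult c (z *\<^sub>C x) = z *\<^sub>C left_mult c x"
  by (simp_all add: left_mult_def unitization_defs scaleC_distribs algebra_simps scaleC_scaleC)

lemma left_mult_diff: "left_mult (c - d) x = left_mult c x - left_mult d x"
  by (simp add: left_mult_def unitization_defs scaleC_distribs algebra_simps)

lemma star_left_mult_mult: "star (left_mult c x) * left_mult c x = star x * left_mult (star c * c) x"
proof -
  have "incl (star (left_mult c x) * left_mult c x) = incl (star x * left_mult (star c * c) x)"
    by (simp add: incl_simps incl_left_mult star_mult mult.assoc)
  then show ?thesis by simp
qed

locale cstar_algebra_seminorm =
  fixes p :: "'a::complex_star_algebra \<Rightarrow> real"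
  assumes cstar_seminorm_p: "cstar_seminorm p"
begin

lemmas seminorm_p = cstar_seminorm_seminorm[OF cstar_seminorm_p]
  and p_cstar = cstar_seminorm_cstar[OF cstar_seminorm_p]

lemmas p_nonneg [simp] = seminorm_nonneg[OF seminorm_p]
  and p_triangle = seminorm_triangle[OF seminorm_p]
  and p_scaleC = seminorm_scaleC[OF seminorm_p]
  and p_diff = seminorm_diff[OF seminorm_p]

text \<open>
  Polarization writes \<open>4 y\<^sup>*x\<close> as a combination of four elements \<open>a\<^sup>*a\<close>, whose seminorms are known.
  The factor \<open>4\<close> is removed in \<open>p_mult\<close>.
\<close>

lemma p_star_mult_le: "p (star y * x) \<le> 4 * p y * p x"
proof -
  have le1: "p (star y * x) \<le> 4" if "p x \<le> 1" "p y \<le> 1" for x y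
  proof -
    define f where "f = (\<lambda>c. star (x + c *\<^sub>C y) * (x + c *\<^sub>C y))"
    have f: "p (f c) \<le> 4" if "cmod c = 1" for c
    proof -
      have "p (x + c *\<^sub>C y) \<le> 2"
        using p_triangle[of x "c *\<^sub>C y"] \<open>p x \<le> 1\<close> \<open>p y \<le> 1\<close> that by (simp add: p_scaleC)
      then show ?thesis using power_mono[of "p (x + c *\<^sub>C y)" 2 2] by (simp add: f_def p_cstar)
    qed
    have "4 *\<^sub>C (star y * x) = f 1 - f (-1) + (\<i> *\<^sub>C f \<i> - \<i> *\<^sub>C f (-\<i>))"
      unfolding f_def by (rule polarization[where B = "\<lambda>u v. star u * v"])
        (simp_all add: star_simps scaleC_distribs distrib_left distrib_right)
    then have "4 * p (star y * x) = p (f 1 - f (-1) + (\<i> *\<^sub>C f \<i> - \<i> *\<^sub>C f (-\<i>)))"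
      using p_scaleC[of 4 "star y * x"] by simp
    also have "\<dots> \<le> (p (f 1) + p (f (-1))) + (p (f \<i>) + p (f (-\<i>)))"
      using p_triangle[of "f 1 - f (-1)" "\<i> *\<^sub>C f \<i> - \<i> *\<^sub>C f (-\<i>)"] p_diff[of "f 1" "f (-1)"]
        p_diff[of "\<i> *\<^sub>C f \<i>" "\<i> *\<^sub>C f (-\<i>)"] by (simp add: p_scaleC)
    also have "\<dots> \<le> 16" using f[of 1] f[of "-1"] f[of \<i>] f[of "-\<i>"] by simp
    finally show ?thesis by simp
  qed
  have le2: "p (star y * x) \<le> 4 * p x" if "p y \<le> 1" for x y
    by (rule bounded_by_homogeneity[where N = "\<lambda>x. p (star y * x)" and q = p])
      (use that le1 in \<open>simp_all add: scaleC_mult_right p_scaleC\<close>)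
  have "p (star y * x) \<le> 4 * p x * p y"
    by (rule bounded_by_homogeneity[where N = "\<lambda>y. p (star y * x)" and q = p])
      (use le2 in \<open>simp_all add: scaleC_mult_left star_scaleC p_scaleC\<close>)
  then show ?thesis by (simp add: mult_ac)
qed

text \<open>
  The seminorm of left multiplication on the original algebra.  It is submultiplicative whatever
  constant holds in \<open>p_star_mult_le\<close>, so that approximate square roots exist for it.
\<close>

definition op_norm :: "'a unitization \<Rightarrow> real" where
  "op_norm c = Inf {C. 0 \<le> C \<and> (\<forall>x. p (left_mult c x) \<le> C * p x)}"

lemma left_mult_bounded: "{C. 0 \<le> C \<and> (\<forall>x. p (left_mult c x) \<le> C * p x)} \<noteq> {}"
proof -
  have "p (left_mult c x) \<le> (cmod (scalar c) + 4 * p (star (element c))) * p x" for x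
    using p_triangle[of "scalar c *\<^sub>C x" "element c * x"] p_star_mult_le[of "star (element c)" x]
    by (simp add: left_mult_def p_scaleC star_star algebra_simps)
  moreover have "0 \<le> cmod (scalar c) + 4 * p (star (element c))" by simp
  ultimately show ?thesis by blast
qed

lemma p_left_mult: "p (left_mult c x) \<le> op_norm c * p x"
proof -
  show ?thesis
  proof (cases "p x = 0")
    case True
    obtain C where "p (left_mult c x) \<le> C * p x" using left_mult_bounded[of c] by blast
    then show ?thesis using True by simp
  next
    case False
    then have x: "p x > 0" by (simp add: less_le)
    have "p (left_mult c x) / p x \<le> op_norm c"
      unfolding op_norm_def
      by (rule cInf_greatest) (use left_mult_bounded[of c] x in \<open>auto simp: pos_divide_le_eq\<close>)
    then show ?thesis using x by (simp add: pos_divide_le_eq)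
  qed
qed

lemma op_norm_le: "0 \<le> C \<Longrightarrow> (\<And>x. p (left_mult c x) \<le> C * p x) \<Longrightarrow> op_norm c \<le> C"
  unfolding op_norm_def by (rule cInf_lower) (auto intro!: bdd_belowI[of _ 0])

lemma op_norm_nonneg: "0 \<le> op_norm c"
  unfolding op_norm_def by (rule cInf_greatest[OF left_mult_bounded]) auto

lemma op_norm_scaleC_le: "op_norm (z *\<^sub>C c) \<le> cmod z * op_norm c"
  by (rule op_norm_le)
    (simp_all add: op_norm_nonneg left_mult_simps p_scaleC mult.assoc p_left_mult mult_left_mono)

sublocale op: submultiplicative_seminorm op_norm
proof
  show "seminorm op_norm"
    unfolding seminorm_def
  proof (intro conjI allI)
    show "op_norm (c + d) \<le> op_norm c + op_norm d" for c d
    proof (rule op_norm_le)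
      show "p (left_mult (c + d) x) \<le> (op_norm c + op_norm d) * p x" for x
        using p_triangle[of "left_mult c x" "left_mult d x"] p_left_mult[of c x] p_left_mult[of d x]
        by (simp add: left_mult_simps distrib_right)
    qed (simp add: op_norm_nonneg)
    show "op_norm (z *\<^sub>C c) = cmod z * op_norm c" for z c
    proof (cases "z = 0")
      case True
      then show ?thesis using op_norm_scaleC_le[of 0 c] op_norm_nonneg[of 0] by simp
    next
      case False
      then have "cmod z * op_norm c \<le> cmod z * (cmod (1 / z) * op_norm (z *\<^sub>C c))"
        using op_norm_scaleC_le[of "1 / z" "z *\<^sub>C c"] by (simp add: scaleC_scaleC del: norm_divide)
      also have "\<dots> = op_norm (z *\<^sub>C c)" using False by (simp add: norm_divide)
      finally show ?thesis using op_norm_scaleC_le[of z c] by simp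
    qed
  qed (rule op_norm_nonneg)
  show "op_norm (c * d) \<le> op_norm c * op_norm d" for c d
  proof (rule op_norm_le)
    show "p (left_mult (c * d) x) \<le> op_norm c * op_norm d * p x" for x
    proof -
      have "p (left_mult (c * d) x) \<le> op_norm c * p (left_mult d x)"
        by (simp add: left_mult_simps p_left_mult)
      also have "\<dots> \<le> op_norm c * (op_norm d * p x)"
        by (intro mult_left_mono p_left_mult op_norm_nonneg)
      finally show ?thesis by (simp add: mult.assoc)
    qed
  qed (simp add: op_norm_nonneg)
  show "op_norm 1 \<le> 1" by (rule op_norm_le) (simp_all add: left_mult_simps)
qed

text \<open>
  If \<open>r\<^sup>2 \<approx> 1 - h\<^sup>2\<close> and \<open>r\<close> commutes with \<open>h\<close>, then \<open>E = h \<plusminus> ir\<close> is nearly unitary and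
  \<open>p(Ex)\<^sup>2 = p(x\<^sup>*E\<^sup>*Ex) \<approx> p(x)\<^sup>2\<close>.  So \<open>h\<close> is the mean of two elements of norm at most
  \<open>1\<close>, up to the error, without any loss of a constant.
\<close>

lemma op_norm_le_one_of_square:
  assumes h: "star h = h" "op_norm (h * h) \<le> 1" shows "op_norm h \<le> 1"
proof (rule field_le_epsilon)
  fix e :: real assume e: "e > 0"
  have "star (h * h) = h * h" using h(1) by (simp add: star_mult)
  then obtain r where r: "star r = r" "\<And>v. v * (h * h) = h * h * v \<Longrightarrow> v * r = r * v"
      "op_norm (1 - h * h - r * r) \<le> e / 4"
    using op.approx_sqrt[OF h(2), of "e / 4"] e by (metis zero_less_divide_iff zero_less_numeral)
  have hr: "h * r = r * h" by (rule r(2)) (simp add: mult.assoc)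
  have near_unitary: "op_norm (h + z *\<^sub>C r) \<le> 1 + e" if z: "z = \<i> \<or> z = - \<i>" for z
  proof (rule op_norm_le)
    fix x
    define E where "E = h + z *\<^sub>C r"
    define D where "D = 1 - h * h - r * r"
    have "star E * E = 1 - D"
      unfolding D_def
      using hr z by (auto simp: E_def star_simps h(1) r(1) algebra_simps scaleC_distribs scaleC_scaleC)
    then have "star (left_mult E x) * left_mult E x = star x * x - star x * left_mult D x"
      by (simp add: star_left_mult_mult left_mult_diff left_mult_simps right_diff_distrib)
    then have "(p (left_mult E x))\<^sup>2 \<le> (p x)\<^sup>2 + p (star x * left_mult D x)"
      by (metis p_cstar p_diff)
    also have "\<dots> \<le> (p x)\<^sup>2 + 4 * p x * (op_norm D * p x)"
      by (intro add_left_mono order_trans[OF p_star_mult_le] mult_left_mono p_left_mult) simp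
    also have "\<dots> \<le> (p x)\<^sup>2 + 4 * p x * (e / 4 * p x)"
      using r(3) unfolding D_def by (intro add_left_mono mult_left_mono mult_right_mono) auto
    also have "\<dots> = (1 + e) * (p x)\<^sup>2" by (simp add: power2_eq_square algebra_simps)
    also have "\<dots> \<le> (1 + e)\<^sup>2 * (p x)\<^sup>2"
      using e by (intro mult_right_mono) (auto simp: power2_eq_square algebra_simps)
    also have "\<dots> = ((1 + e) * p x)\<^sup>2" by (simp add: power_mult_distrib)
    finally have "p (left_mult E x) \<le> (1 + e) * p x"
      by (rule power2_le_imp_le) (use e in simp)
    then show "p (left_mult (h + z *\<^sub>C r) x) \<le> (1 + e) * p x" by (simp only: E_def)
  qed (use e in simp)
  have "2 *\<^sub>C h = (h + \<i> *\<^sub>C r) + (h + (- \<i>) *\<^sub>C r)"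
    using cvec.scale_left_distrib[of 1 1 h] by simp
  then have "2 * op_norm h \<le> op_norm (h + \<i> *\<^sub>C r) + op_norm (h + (- \<i>) *\<^sub>C r)"
    by (metis op.L_scaleC op.L_triangle norm_numeral)
  then show "op_norm h \<le> 1 + e" using near_unitary[of \<i>] near_unitary[of "-\<i>"] by simp
qed

lemma op_norm_square_le:
  assumes "star h = h" shows "(op_norm h)\<^sup>2 \<le> op_norm (h * h)"
proof (rule field_le_epsilon)
  fix e :: real assume e: "e > 0"
  define t where "t = op_norm (h * h) + e"
  have t: "t > 0" using e op_norm_nonneg[of "h * h"] by (simp add: t_def add_nonneg_pos)
  define k where "k = complex_of_real (1 / sqrt t) *\<^sub>C h"
  have kk: "k * k = complex_of_real (1 / t) *\<^sub>C (h * h)"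
    using t by (simp add: k_def scaleC_mult_left scaleC_mult_right of_real_mult[symmetric] del: of_real_mult)
  have "op_norm (h * h) \<le> t" using e by (simp add: t_def)
  then have "op_norm (k * k) \<le> 1" unfolding kk using t by (simp add: op.L_scaleC norm_divide)
  moreover have "star k = k" using assms by (simp add: k_def star_simps)
  ultimately have "op_norm k \<le> 1" by (metis op_norm_le_one_of_square)
  then have "op_norm h \<le> sqrt t" unfolding k_def using t by (simp add: op.L_scaleC norm_divide)
  then have "(op_norm h)\<^sup>2 \<le> (sqrt t)\<^sup>2" by (intro power_mono) (auto simp: op_norm_nonneg)
  then show "(op_norm h)\<^sup>2 \<le> op_norm (h * h) + e" using t by (simp add: t_def)
qed

lemma op_norm_power_selfadjoint:
  assumes "star h = h" shows "op_norm h ^ 2 ^ k \<le> op_norm (h ^ 2 ^ k)"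
proof (induction k)
  case (Suc k)
  have "op_norm h ^ 2 ^ Suc k = (op_norm h ^ 2 ^ k)\<^sup>2" by (simp add: power_mult[symmetric] mult.commute)
  also have "\<dots> \<le> (op_norm (h ^ 2 ^ k))\<^sup>2" using Suc by (intro power_mono) (auto simp: op_norm_nonneg)
  also have "\<dots> \<le> op_norm (h ^ 2 ^ k * h ^ 2 ^ k)" by (intro op_norm_square_le star_power_selfadjoint assms)
  also have "h ^ 2 ^ k * h ^ 2 ^ k = h ^ 2 ^ Suc k" by (simp add: power_add[symmetric] mult_2)
  finally show ?case .
qed simp

text \<open>
  Again a comparison of growth: \<open>(uv)\<^sup>n\<^sup>+\<^sup>1 = u (vu)\<^sup>n v\<close>.
\<close>

lemma op_norm_swap_le:
  assumes "star (u * v) = u * v" shows "op_norm (u * v) \<le> op_norm (v * u)"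
proof (cases "op_norm (u * v) = 0")
  case True
  then show ?thesis by (simp add: op_norm_nonneg)
next
  case False
  then have pos: "op_norm (u * v) > 0" using op_norm_nonneg[of "u * v"] by linarith
  have swap: "(u * v) ^ Suc n = u * (v * u) ^ n * v" for n
    by (induction n) (simp_all add: mult.assoc)
  show ?thesis
  proof (rule le_of_powers_bounded[where K = "op_norm u * op_norm v / op_norm (u * v)"])
    fix m
    define n :: nat where "n = 2 ^ m - 1"
    have n: "Suc n = 2 ^ m" by (simp add: n_def)
    have "op_norm (u * v) ^ Suc n \<le> op_norm (u * (v * u) ^ n * v)"
      using op_norm_power_selfadjoint[OF assms, of m] by (simp only: n[symmetric] swap)
    also have "\<dots> \<le> op_norm u * op_norm (v * u) ^ n * op_norm v"
      by (rule order_trans[OF op.L_mult], intro mult_right_mono order_trans[OF op.L_mult] mult_left_mono op.L_power)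
        (simp_all add: op_norm_nonneg)
    finally have "op_norm (u * v) ^ n \<le> op_norm u * op_norm v / op_norm (u * v) * op_norm (v * u) ^ n"
      using pos by (simp add: pos_le_divide_eq mult_ac)
    moreover have "n \<ge> m" using n less_exp[of m] by linarith
    ultimately show "\<exists>n\<ge>m. op_norm (u * v) ^ n \<le> op_norm u * op_norm v / op_norm (u * v) * op_norm (v * u) ^ n"
      by blast
  qed (rule op_norm_nonneg)
qed

text \<open>
  For \<open>m = 2\<^sup>k\<close> the \<open>C\<^sup>*\<close>-identity gives \<open>p(a\<^sup>m) = p(a)\<^sup>m\<close>, so that
  \<open>\<parallel>a\<parallel>\<^sup>m \<le> \<parallel>a\<^sup>m\<parallel> \<le> 4 p(a)\<^sup>m\<close>, and the root of order \<open>m\<close> removes the \<open>4\<close>.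
\<close>

lemma op_norm_incl_selfadjoint_le:
  assumes "star a = a" shows "op_norm (incl a) \<le> p a"
proof (rule le_of_powers_bounded[where K = 4])
  have "op_norm (incl a) ^ 2 ^ k \<le> 4 * p a ^ 2 ^ k" for k
    using assms
  proof (induction k arbitrary: a)
    case 0
    have "op_norm (incl a) \<le> 4 * p a"
      by (rule op_norm_le) (use p_star_mult_le[of a] 0 in \<open>simp_all add: left_mult_simps\<close>)
    then show ?case by simp
  next
    case (Suc k)
    have "op_norm (incl a) ^ 2 ^ Suc k = ((op_norm (incl a))\<^sup>2) ^ 2 ^ k" by (simp add: power_mult)
    also have "\<dots> \<le> op_norm (incl (a * a)) ^ 2 ^ k"
    proof (intro power_mono)
      have "star (incl a) = incl a" using Suc.prems by (simp add: incl_simps(3)[symmetric])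
      from op_norm_square_le[OF this] show "(op_norm (incl a))\<^sup>2 \<le> op_norm (incl (a * a))"
        by (simp add: incl_simps(2))
    qed simp
    also have "\<dots> \<le> 4 * p (a * a) ^ 2 ^ k" using Suc by (simp add: star_mult)
    also have "p (a * a) = (p a)\<^sup>2" using p_cstar[of a] Suc.prems by simp
    finally show ?case by (simp add: power_mult)
  qed
  moreover have "2 ^ m \<ge> m" for m :: nat using less_exp[of m] by linarith
  ultimately show "\<exists>n\<ge>m. op_norm (incl a) ^ n \<le> 4 * p a ^ n" for m by blast
qed simp

lemma p_selfadjoint_le:
  assumes "star a = a" shows "p a \<le> op_norm (incl a)"
proof (cases "p a = 0")
  case False
  have "p a * p a = p (a * a)" using p_cstar[of a] assms by (simp add: power2_eq_square)
  also have "\<dots> \<le> op_norm (incl a) * p a" using p_left_mult[of "incl a" a] by (simp add: left_mult_simps)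
  finally show ?thesis using False by (simp add: less_le)
qed (simp add: op_norm_nonneg)

text \<open>
  For \<open>d = c\<^sup>*c\<close>, \<open>p(cx)\<^sup>2 = p(x\<^sup>*dx)\<close>, and moving the outer factor around,
  \<open>\<parallel>x\<^sup>* d x\<parallel> \<le> \<parallel>d x x\<^sup>*\<parallel> \<le> \<parallel>d\<parallel> \<parallel>x x\<^sup>*\<parallel> \<le> \<parallel>d\<parallel> \<parallel>x\<^sup>* x\<parallel> \<le> \<parallel>d\<parallel> p(x)\<^sup>2\<close>.
\<close>

lemma op_norm_square_le_cstar: "(op_norm c)\<^sup>2 \<le> op_norm (star c * c)"
proof -
  let ?d = "star c * c"
  have "op_norm c \<le> sqrt (op_norm ?d)"
  proof (rule op_norm_le)
    fix x :: 'a
    define X where "X = incl x"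
    have "(p (left_mult c x))\<^sup>2 = p (star x * left_mult ?d x)"
      by (simp add: p_cstar[symmetric] star_left_mult_mult)
    also have "\<dots> \<le> op_norm (incl (star x * left_mult ?d x))"
      by (rule p_selfadjoint_le) (simp add: star_left_mult_mult[symmetric] star_simps)
    also have "incl (star x * left_mult ?d x) = star X * (?d * X)"
      by (simp add: incl_simps incl_left_mult X_def)
    also have "op_norm \<dots> \<le> op_norm (?d * X * star X)"
      by (rule op_norm_swap_le) (simp add: star_simps mult.assoc)
    also have "\<dots> \<le> op_norm ?d * op_norm (X * star X)"
      using op.L_mult[of ?d "X * star X"] by (simp only: mult.assoc)
    also have "\<dots> \<le> op_norm ?d * op_norm (star X * X)"
      by (intro mult_left_mono op_norm_swap_le) (simp_all add: star_simps op_norm_nonneg)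
    also have "op_norm (star X * X) \<le> (p x)\<^sup>2"
      using op_norm_incl_selfadjoint_le[of "star x * x"]
      by (simp add: star_simps incl_simps X_def p_cstar)
    finally have "(p (left_mult c x))\<^sup>2 \<le> op_norm ?d * (p x)\<^sup>2"
      by (simp add: mult_left_mono op_norm_nonneg)
    also have "\<dots> = (sqrt (op_norm ?d) * p x)\<^sup>2" by (simp add: power_mult_distrib op_norm_nonneg)
    finally show "p (left_mult c x) \<le> sqrt (op_norm ?d) * p x"
      by (rule power2_le_imp_le) (simp add: op_norm_nonneg)
  qed (simp add: op_norm_nonneg)
  then have "(op_norm c)\<^sup>2 \<le> (sqrt (op_norm ?d))\<^sup>2" by (intro power_mono) (auto simp: op_norm_nonneg)
  then show ?thesis by (simp add: op_norm_nonneg)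
qed

sublocale op: unital_cstar_seminorm op_norm
  by standard (rule op_norm_square_le_cstar)

lemma op_norm_incl: "op_norm (incl a) = p a"
proof (rule antisym)
  have sa: "star (star a * a) = star a * a" by (simp add: star_simps)
  have "(op_norm (incl a))\<^sup>2 \<le> (p a)\<^sup>2"
    using op_norm_incl_selfadjoint_le[OF sa] op.L_cstar[of "incl a"] by (simp add: incl_simps p_cstar)
  then show "op_norm (incl a) \<le> p a" by (rule power2_le_imp_le) simp
  have "(p a)\<^sup>2 \<le> (op_norm (incl a))\<^sup>2"
    using p_selfadjoint_le[OF sa] op.L_cstar[of "incl a"] by (simp add: incl_simps p_cstar)
  then show "p a \<le> op_norm (incl a)" by (rule power2_le_imp_le) (simp add: op_norm_nonneg)
qed

text \<open>
  Sebestyen's theorem: the \<open>C\<^sup>*\<close>-identity alone makes a seminorm submultiplicative.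
\<close>

lemma p_mult: "p (a * b) \<le> p a * p b"
  using op.L_mult[of "incl a" "incl b"] by (simp add: incl_simps(2)[symmetric] op_norm_incl)

lemma p_star: "p (star a) = p a"
  using op.L_star[of "incl a"] by (simp add: incl_simps(3)[symmetric] op_norm_incl)

end

text \<open>
  That \<open>a\<^sup>*a + b\<^sup>*b\<close> is again of the form \<open>c\<^sup>*c\<close> would require square roots; with finite sums of such
  elements, closure under addition is immediate.
\<close>

inductive_set star_sums :: "'a::complex_star_algebra set" where
  zero: "0 \<in> star_sums"
| add: "s \<in> star_sums \<Longrightarrow> star a * a + s \<in> star_sums"

lemma star_sums_add: "s \<in> star_sums \<Longrightarrow> t \<in> star_sums \<Longrightarrow> s + t \<in> star_sums"
  by (induction rule: star_sums.induct) (auto simp: add.assoc intro: star_sums.intros)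

lemma star_sums_star_mult: "star a * a \<in> star_sums"
  using star_sums.add[OF star_sums.zero, of a] by simp

lemma star_sums_sum: "(\<And>i. i \<in> I \<Longrightarrow> f i \<in> star_sums) \<Longrightarrow> sum f I \<in> star_sums"
  by (induction I rule: infinite_finite_induct) (auto intro: star_sums_add star_sums.zero)

lemma cstar_seminorm_mono:
  assumes p: "cstar_seminorm p" and st: "s \<in> star_sums" "t \<in> star_sums"
  shows "p s \<le> p (s + t)"
proof -
  interpret cstar_algebra_seminorm p by standard (rule p)
  have pos: "op.pos (incl r)" if "r \<in> star_sums" for r
    using that
  proof (induction rule: star_sums.induct)
    case zero
    then show ?case by (simp add: incl_simps op.pos_zero)
  next
    case (add s a)
    then show ?case by (simp add: incl_simps op.pos_add op.pos_star_mult)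
  qed
  show ?thesis using op.L_mono[OF pos[OF st(1)] pos[OF st(2)]]
    by (simp add: incl_simps(1)[symmetric] op_norm_incl)
qed

section \<open>Complete positivity on a Hilbert module\<close>

lemma clinearD:
  assumes "clinear f"
  shows clinear_add: "f (x + y) = f x + f y" and clinear_scaleC: "f (c *\<^sub>C x) = c *\<^sub>C f x"
  using assms by (simp_all add: Vector_Spaces.linear_iff)

lemma sum_fun_apply: "(\<Sum>k\<in>A. f k) x = (\<Sum>k\<in>A. f k x :: 'b::comm_monoid_add)"
  by (induction A rule: infinite_finite_induct) simp_all

lemma star_sums_scale:
  assumes "s \<in> star_sums" "0 \<le> r" shows "complex_of_real r *\<^sub>C s \<in> star_sums"
  using assms(1)
proof (induction rule: star_sums.induct)
  case zero
  then show ?case by (simp add: star_sums.zero)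
next
  case (add s a)
  let ?b = "complex_of_real (sqrt r) *\<^sub>C a"
  have "star ?b * ?b = complex_of_real r *\<^sub>C (star a * a)"
    using assms(2) by (simp add: star_scaleC scaleC_mult_left scaleC_mult_right of_real_mult[symmetric] del: of_real_mult)
  then show ?case using star_sums.add[OF add.IH, of ?b] by (simp add: cvec.scale_right_distrib)
qed

context hilbert_module
begin

lemma gram_add_right: "gram g (h + k) = gram g h + gram g k"
  by (rule clinear_add[OF gram_linear])

lemma gram_scaleC_right: "gram g (c *\<^sub>C h) = c *\<^sub>C gram g h"
  by (rule clinear_scaleC[OF gram_linear])

lemma gram_add_left: "gram (g + h) k = gram g k + gram h k"
  using gram_star[of "g + h" k] gram_star[of g k] gram_star[of h k]
  by (simp add: gram_add_right star_add)

lemma gram_scaleC_left: "gram (c *\<^sub>C g) k = cnj c *\<^sub>C gram g k"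
  using gram_star[of "c *\<^sub>C g" k] gram_star[of g k] by (simp add: gram_scaleC_right star_scaleC)

lemma gram_zero_right [simp]: "gram g 0 = 0"
  using gram_scaleC_right[of g 0 0] by simp

lemma gram_zero_left [simp]: "gram 0 g = 0"
  using gram_scaleC_left[of 0 0 g] by simp

lemma gram_diff_right: "gram g (h - k) = gram g h - gram g k"
  using gram_add_right[of g "h - k" k] by simp

lemma gram_diff_left: "gram (g - h) k = gram g k - gram h k"
  using gram_add_left[of "g - h" h k] by simp

lemma gram_sum_right: "gram g (\<Sum>i\<in>I. f i) = (\<Sum>i\<in>I. gram g (f i))"
  by (induction I rule: infinite_finite_induct) (simp_all add: gram_add_right)

lemma gram_sum_left: "gram (\<Sum>i\<in>I. f i) g = (\<Sum>i\<in>I. gram (f i) g)"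
  by (induction I rule: infinite_finite_induct) (simp_all add: gram_add_left)

lemma gram_star_sums: "gram h h \<in> star_sums"
  using gram_positive[of h] by (auto simp: positives_def star_sums_star_mult)

lemma adjoint_op_adjoint:
  assumes "T \<in> adjointables gram" shows "is_adjoint gram T (adjoint_op gram T)"
proof -
  obtain S where S: "is_adjoint gram T S" using assms by (auto simp: adjointables_def)
  have "S' = S" if "is_adjoint gram T S'" for S'
  proof
    fix k
    have "gram h (S' k - S k) = 0" for h
      using S that by (simp add: is_adjoint_def gram_diff_right)
    then show "S' k = S k" using gram_eq_zero_iff[of "S' k - S k"] by simp
  qed
  with S show ?thesis unfolding adjoint_op_def by (rule theI)
qed

lemma gram_adjoint_op:
  assumes "T \<in> adjointables gram" shows "gram (adjoint_op gram T h) k = gram h (T k)"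
  using adjoint_op_adjoint[OF assms] unfolding is_adjoint_def by (metis gram_star)

text \<open>
  The matrix \<open>[y\<^sub>i\<^sup>* y\<^sub>j]\<close> is \<open>Y\<^sup>*Y\<close> for the matrix \<open>Y\<close> with first row \<open>y\<close> and zeros elsewhere.  Hence
  \<open>[\<phi>(y\<^sub>i\<^sup>* y\<^sub>j)] = S\<^sup>*S\<close> for a matrix \<open>S\<close> of adjointable operators, and the sum is
  \<open>\<Sum>\<^sub>k [v\<^sub>k, v\<^sub>k]\<close> with \<open>v\<^sub>k = \<Sum>\<^sub>j S\<^sub>k\<^sub>j h\<^sub>j\<close>.
\<close>

lemma completely_positive_form_star_sums:
  fixes n :: nat
  assumes cp: "completely_positive (adjointables gram) (\<circ>) (adjoint_op gram) \<phi>"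
  shows "(\<Sum>i<n. \<Sum>j<n. gram (\<phi> (star (y i) * y j) (h j)) (h i)) \<in> star_sums"
proof -
  define Y where "Y = (\<lambda>i j. if i = (0 :: nat) \<and> j < n then y j else 0)"
  have "Y \<in> mat_carrier n UNIV" by (auto simp: mat_carrier_def Y_def)
  then have "mat_mult n (*) (mat_star n star Y) Y \<in> mat_positives n UNIV (*) star"
    by (auto simp: mat_positives_def positives_def)
  then have "mat_map n \<phi> (mat_mult n (*) (mat_star n star Y) Y)
      \<in> mat_positives n (adjointables gram) (\<circ>) (adjoint_op gram)"
    using cp unfolding completely_positive_def by blast
  then obtain S where S: "S \<in> mat_carrier n (adjointables gram)"
    and eq: "mat_map n \<phi> (mat_mult n (*) (mat_star n star Y) Y)
        = mat_mult n (\<circ>) (mat_star n (adjoint_op gram) S) S"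
    by (auto simp: mat_positives_def positives_def)
  have S_adj: "S i j \<in> adjointables gram" if "i < n" "j < n" for i j
    using S that by (auto simp: mat_carrier_def)
  have entry: "\<phi> (star (y i) * y j) = (\<Sum>k<n. adjoint_op gram (S k i) \<circ> S k j)" if ij: "i < n" "j < n" for i j
  proof -
    have "(\<Sum>k<n. star (Y k i) * Y k j) = (\<Sum>k<n. if k = 0 then star (y i) * y j else 0)"
      using ij by (intro sum.cong) (auto simp: Y_def)
    also have "\<dots> = star (y i) * y j" using ij by simp
    finally have 1: "mat_mult n (*) (mat_star n star Y) Y i j = star (y i) * y j"
      using ij by (simp add: mat_mult_def mat_star_def)
    have "mat_map n \<phi> (mat_mult n (*) (mat_star n star Y) Y) i j
        = mat_mult n (\<circ>) (mat_star n (adjoint_op gram) S) S i j" by (simp only: eq)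
    then show ?thesis using ij 1 by (simp add: mat_map_def) (simp add: mat_mult_def mat_star_def)
  qed
  define v where "v k = (\<Sum>j<n. S k j (h j))" for k
  have "(\<Sum>i<n. \<Sum>j<n. gram (\<phi> (star (y i) * y j) (h j)) (h i))
      = (\<Sum>i<n. \<Sum>j<n. \<Sum>k<n. gram (S k j (h j)) (S k i (h i)))"
    by (intro sum.cong refl)
      (simp add: entry sum_fun_apply gram_sum_left gram_adjoint_op S_adj)
  also have "\<dots> = (\<Sum>i<n. \<Sum>k<n. \<Sum>j<n. gram (S k j (h j)) (S k i (h i)))"
    by (intro sum.cong refl sum.swap)
  also have "\<dots> = (\<Sum>k<n. \<Sum>i<n. \<Sum>j<n. gram (S k j (h j)) (S k i (h i)))"
    by (rule sum.swap)
  also have "\<dots> = (\<Sum>k<n. gram (v k) (v k))"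
    by (simp add: v_def gram_sum_left gram_sum_right)
  also have "\<dots> \<in> star_sums" by (intro star_sums_sum gram_star_sums)
  finally show ?thesis .
qed

text \<open>
  A weak Cauchy--Schwarz inequality: polarize, and bound each \<open>[k + cg, k + cg]\<close> through the
  parallelogram identity and monotonicity.
\<close>

lemma seminorm_gram_le:
  assumes p: "cstar_seminorm p"
  shows "p (gram g k) \<le> 2 * (p (gram g g) + p (gram k k))"
proof -
  note sn = cstar_seminorm_seminorm[OF p]
  define f where "f c = gram (k + c *\<^sub>C g) (k + c *\<^sub>C g)" for c
  have f: "p (f c) \<le> 2 * (p (gram g g) + p (gram k k))" if c: "cmod c = 1" for c
  proof -
    have cc: "cnj c * c = 1" using c by (simp add: complex_norm_square[symmetric] mult.commute)
    have two: "(2::complex) *\<^sub>C v = v + v" for v :: 'a using cvec.scale_left_distrib[of 1 1 v] by simp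
    have "p (f c) \<le> p (f c + f (- c))"
      unfolding f_def by (intro cstar_seminorm_mono p gram_star_sums)
    also have "f c + f (- c) = 2 *\<^sub>C gram k k + 2 *\<^sub>C gram g g"
      using cc by (simp add: f_def two gram_add_right gram_add_left gram_diff_right gram_diff_left
        gram_scaleC_right gram_scaleC_left
        algebra_simps scaleC_distribs scaleC_scaleC)
    also have "p \<dots> \<le> 2 * p (gram k k) + 2 * p (gram g g)"
      using seminorm_triangle[OF sn] seminorm_scaleC[OF sn, of 2] by (metis norm_numeral)
    finally show ?thesis by simp
  qed
  have "4 * p (gram g k) = p (4 *\<^sub>C gram g k)" using seminorm_scaleC[OF sn, of 4] by simp
  also have "\<dots> = p (f 1 - f (-1) + (\<i> *\<^sub>C f \<i> - \<i> *\<^sub>C f (-\<i>)))"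
    using polarization[of gram g k]
    by (simp add: f_def gram_add_left gram_add_right gram_scaleC_left gram_scaleC_right)
  also have "\<dots> \<le> (p (f 1) + p (f (-1))) + (p (f \<i>) + p (f (-\<i>)))"
    using seminorm_triangle[OF sn, of "f 1 - f (-1)" "\<i> *\<^sub>C f \<i> - \<i> *\<^sub>C f (-\<i>)"]
      seminorm_diff[OF sn, of "f 1" "f (-1)"]
      seminorm_diff[OF sn, of "\<i> *\<^sub>C f \<i>" "\<i> *\<^sub>C f (-\<i>)"] by (simp add: seminorm_scaleC[OF sn])
  also have "\<dots> \<le> 4 * (2 * (p (gram g g) + p (gram k k)))"
    using f[of 1] f[of "-1"] f[of \<i>] f[of "-\<i>"] by simp
  finally show ?thesis by simp
qed

end

section \<open>Continuity in terms of seminorms\<close>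

lemma eventually_seminorm_uniformityE:
  fixes P :: "('x::minus \<Rightarrow> real) set"
  assumes "eventually R (seminorm_uniformity P)"
  obtains F e where "F \<subseteq> P" "finite F" "e > 0"
    "\<And>x y. (\<And>p. p \<in> F \<Longrightarrow> p (x - y) < e) \<Longrightarrow> R (x, y)"
proof -
  define A where "A = (\<lambda>(p, e). {(x :: 'x, y). p (x - y) < (e::real)})"
  have "(INF pe\<in>P \<times> {0<..}. principal (A pe)) \<le> seminorm_uniformity P"
    unfolding seminorm_uniformity_def
  proof (intro INF_greatest)
    fix p and e :: real assume "p \<in> P" "e \<in> {0<..}"
    then show "(INF pe\<in>P \<times> {0<..}. principal (A pe)) \<le> principal {(x, y). p (x - y) < e}"
      by (intro INF_lower2[of "(p, e)"]) (auto simp: A_def)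
  qed
  then have "eventually R (INF pe\<in>P \<times> {0<..}. principal (A pe))" using assms by (rule filter_leD)
  then obtain X where X: "X \<subseteq> P \<times> {0<..}" "finite X" "eventually R (INF pe\<in>X. principal (A pe))"
    unfolding eventually_INF[of _ _ "P \<times> {0<..}"] by blast
  then have R: "R z" if "\<And>pe. pe \<in> X \<Longrightarrow> z \<in> A pe" for z
    using that by (auto simp: INF_principal_finite eventually_principal)
  define e where "e = Min (insert 1 (snd ` X))"
  have e: "e > 0" using X(1,2) unfolding e_def by (subst Min_gr_iff) auto
  have le: "e \<le> snd pe" if "pe \<in> X" for pe unfolding e_def using X(2) that by (intro Min_le) auto
  show thesis
  proof (rule that[of "fst ` X" e])
    fix x y assume small: "\<And>p. p \<in> fst ` X \<Longrightarrow> p (x - y) < e"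
    show "R (x, y)"
    proof (rule R)
      fix pe assume "pe \<in> X"
      then have "fst pe (x - y) < snd pe" using small[of "fst pe"] le[of pe] by force
      then show "(x, y) \<in> A pe" by (simp add: A_def case_prod_unfold)
    qed
  qed (use X e in auto)
qed

lemma open_zero_seminorm_ball:
  fixes U :: "'b::locally_cstar_algebra set"
  assumes "open U" "0 \<in> U"
  obtains F e where "finite F" "\<And>s. s \<in> F \<Longrightarrow> cstar_seminorm s" "e > 0"
    "\<And>z. (\<And>s. s \<in> F \<Longrightarrow> s z < e) \<Longrightarrow> z \<in> U"
proof -
  obtain P :: "('b \<Rightarrow> real) set" where P: "\<And>p. p \<in> P \<Longrightarrow> cstar_seminorm p"
    and unif: "uniformity = seminorm_uniformity P"
    using uniformity_cstar_seminorms by blast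
  have "eventually (\<lambda>(x, y). x = 0 \<longrightarrow> y \<in> U) uniformity"
    using assms by (simp add: open_uniformity)
  then obtain F e where F: "F \<subseteq> P" "finite F" "e > 0"
    "\<And>x y. (\<And>p. p \<in> F \<Longrightarrow> p (x - y) < e) \<Longrightarrow> x = 0 \<longrightarrow> y \<in> U"
    unfolding unif by (rule eventually_seminorm_uniformityE) auto
  have ball: "z \<in> U" if z: "\<And>s. s \<in> F \<Longrightarrow> s z < e" for z
  proof -
    have "s (0 - z) < e" if "s \<in> F" for s
      using z[OF that] seminorm_minus[OF cstar_seminorm_seminorm[OF P], of s z] that F(1) by auto
    then show ?thesis using F(4)[of 0 z] by blast
  qed
  have "cstar_seminorm s" if "s \<in> F" for s using that F(1) P by blast
  then show thesis by (rule that[OF F(2) _ F(3) ball])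
qed

context hilbert_module
begin

lemma zero_adjointable: "0 \<in> adjointables gram"
proof -
  have "clinear (0 :: 'h \<Rightarrow> 'h)"
    by (auto simp: Vector_Spaces.linear_iff cvec.vector_space_axioms)
  then show ?thesis by (auto simp: adjointables_def is_adjoint_def intro!: exI[of _ 0])
qed

text \<open>
  The form in which continuity is used: finitely many \<open>C\<^sup>*\<close>-seminorms of \<open>B\<close> control the operator
  seminorm of \<open>\<phi> z\<close> for the given \<open>p\<close>.  The conclusion says that \<open>\<phi> z\<close> is contractive for the seminorm
  \<open>hnorm gram p\<close>, squared to avoid the square root.
\<close>

lemma continuous_contractive_near_zero:
  fixes \<phi> :: "'b::locally_cstar_algebra \<Rightarrow> 'h \<Rightarrow> 'h"
  assumes cont: "continuous_map euclidean (adjointables_topology gram) \<phi>"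
    and lin: "clinear \<phi>" and p: "p \<in> S\<^sub>*"
  obtains F e where "finite F" "\<And>s. s \<in> F \<Longrightarrow> cstar_seminorm s" "e > 0"
    "\<And>z g. (\<And>s. s \<in> F \<Longrightarrow> s z < e) \<Longrightarrow> p (gram (\<phi> z g) (\<phi> z g)) \<le> p (gram g g)"
proof -
  have sn: "seminorm p" using p by (auto simp: cont_cstar_seminorms_def cstar_seminorm_def)
  let ?O = "{T \<in> adjointables gram. op_seminorm gram p (T - 0) < ennreal 1}"
  have "openin (adjointables_topology gram) ?O"
    unfolding adjointables_topology_def
  proof (rule topology_generated_by_Basis, unfold mem_Collect_eq)
    show "\<exists>q T\<^sub>0 e. ?O = {T \<in> adjointables gram. op_seminorm gram q (T - T\<^sub>0) < ennreal e} \<and>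
        q \<in> S\<^sub>* \<and> T\<^sub>0 \<in> adjointables gram \<and> 0 < e"
      by (rule exI[of _ p], rule exI[of _ 0], rule exI[of _ 1]) (simp add: p zero_adjointable)
  qed
  then have "openin euclidean {z \<in> topspace euclidean. \<phi> z \<in> ?O}"
    by (rule openin_continuous_map_preimage[OF cont])
  then have op: "open {z. \<phi> z \<in> ?O}" by simp
  have \<phi>0: "\<phi> 0 = 0" using clinear_scaleC[OF lin, of 0 0] by simp
  have "op_seminorm gram p 0 \<le> ennreal 0"
    unfolding op_seminorm_def
    by (rule Inf_lower) (auto simp: hnorm_def seminorm_zero[OF sn] intro!: exI[of _ "0::real"])
  then have "\<phi> 0 \<in> ?O" using zero_adjointable by (simp add: \<phi>0)
  then have zero: "0 \<in> {z. \<phi> z \<in> ?O}" by simp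
  show thesis
  proof (rule open_zero_seminorm_ball[OF op zero])
    fix F :: "('b \<Rightarrow> real) set" and e :: real
    assume F: "finite F" "\<And>s. s \<in> F \<Longrightarrow> cstar_seminorm s" "e > 0"
      and ball: "\<And>z. (\<And>s. s \<in> F \<Longrightarrow> s z < e) \<Longrightarrow> z \<in> {z. \<phi> z \<in> ?O}"
    have contr: "p (gram (\<phi> z g) (\<phi> z g)) \<le> p (gram g g)" if z: "\<And>s. s \<in> F \<Longrightarrow> s z < e" for z g
    proof -
      have "op_seminorm gram p (\<phi> z) < ennreal 1" 
      proof -
        have "z \<in> {z. \<phi> z \<in> ?O}" by (rule ball) (rule z)
        then show ?thesis by simp
      qed
      then obtain C where C: "0 \<le> C" "ennreal C < ennreal 1" "hnorm gram p (\<phi> z g) \<le> C * hnorm gram p g"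
        unfolding op_seminorm_def Inf_less_iff by auto
      have "C \<le> 1" using C(1,2) by (simp add: ennreal_less_iff)
      moreover have "0 \<le> hnorm gram p g" by (simp add: hnorm_def seminorm_nonneg[OF sn])
      ultimately have "C * hnorm gram p g \<le> 1 * hnorm gram p g" by (rule mult_right_mono)
      then have "hnorm gram p (\<phi> z g) \<le> hnorm gram p g" using C(3) by linarith
      then show ?thesis by (simp add: hnorm_def)
    qed
    show thesis by (rule that[of F e]) (fact F contr)+
  qed
qed

lemma form_bounded:
  fixes \<phi> :: "'b::locally_cstar_algebra \<Rightarrow> 'h \<Rightarrow> 'h"
  assumes lin: "clinear \<phi>" and p: "cstar_seminorm p"
    and F: "finite F" "\<And>s. s \<in> F \<Longrightarrow> cstar_seminorm s" and e: "e > 0"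
    and contr: "\<And>z g. (\<And>s. s \<in> F \<Longrightarrow> s z < e) \<Longrightarrow> p (gram (\<phi> z g) (\<phi> z g)) \<le> p (gram g g)"
  shows "\<exists>K\<ge>0. \<forall>z. p (gram (\<phi> z g) k) \<le> K * (\<Sum>s\<in>F. s z)"
proof -
  note sp = cstar_seminorm_seminorm[OF p] and sF = cstar_seminorm_seminorm[OF F(2)]
  define K where "K = 2 * (p (gram g g) + p (gram k k))"
  have K: "0 \<le> K" by (simp add: K_def seminorm_nonneg[OF sp])
  have nonneg: "0 \<le> s z" if "s \<in> F" for s z by (rule seminorm_nonneg[OF sF[OF that]])
  have "p (gram (\<phi> z g) k) \<le> K * (2 / e * (\<Sum>s\<in>F. s z))" for z
  proof (rule bounded_by_homogeneity[where N = "\<lambda>z. p (gram (\<phi> z g) k)" and q = "\<lambda>z. 2 / e * (\<Sum>s\<in>F. s z)"])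
    fix t :: real and z assume t: "t > 0"
    show "p (gram (\<phi> (complex_of_real t *\<^sub>C z) g) k) = t * p (gram (\<phi> z g) k)"
      using t by (simp add: clinear_scaleC[OF lin] scaleC_fun_def gram_scaleC_left seminorm_scaleC[OF sp])
    show "2 / e * (\<Sum>s\<in>F. s (complex_of_real t *\<^sub>C z)) = t * (2 / e * (\<Sum>s\<in>F. s z))"
    proof -
      have "s (complex_of_real t *\<^sub>C z) = t * s z" if "s \<in> F" for s
        using seminorm_scaleC[OF sF[OF that], of "complex_of_real t" z] t by simp
      then have "(\<Sum>s\<in>F. s (complex_of_real t *\<^sub>C z)) = t * (\<Sum>s\<in>F. s z)"
        by (simp add: sum_distrib_left cong: sum.cong)
      then show ?thesis by simp
    qed
  next
    fix z
    have "0 \<le> (\<Sum>s\<in>F. s z)" by (rule sum_nonneg) (rule nonneg)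
    then show "0 \<le> 2 / e * (\<Sum>s\<in>F. s z)" using e by simp
    assume small: "2 / e * (\<Sum>s\<in>F. s z) \<le> 1"
    have "s z < e" if s: "s \<in> F" for s
    proof -
      have "s z \<le> (\<Sum>s\<in>F. s z)" by (rule member_le_sum[OF s _ F(1)], rule nonneg, simp)
      also have "\<dots> \<le> e / 2" using small e by (simp add: field_simps)
      finally show ?thesis using e by simp
    qed
    then have "p (gram (\<phi> z g) (\<phi> z g)) \<le> p (gram g g)" by (rule contr)
    then show "p (gram (\<phi> z g) k) \<le> K" using seminorm_gram_le[OF p, of "\<phi> z g" k] by (simp add: K_def)
  qed (rule K)
  then show ?thesis using K e by (intro exI[of _ "K * (2 / e)"]) (auto simp: mult.assoc)
qed

end

section \<open>Iterating the inequality\<close>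

primrec iterated_square :: "'b::complex_star_algebra \<Rightarrow> nat \<Rightarrow> 'b" where
  "iterated_square b 0 = b"
| "iterated_square b (Suc k) = star (iterated_square b k) * iterated_square b k"

lemma cstar_seminorm_iterated_square:
  "cstar_seminorm s \<Longrightarrow> s (iterated_square b k) = s b ^ 2 ^ k"
  by (induction k) (simp_all add: cstar_seminorm_cstar power_mult[symmetric] mult.commute)

text \<open>
  The bound is read off at \<open>t = y / z\<close>, where the quadratic is smallest; for \<open>z = 0\<close> a large \<open>t\<close> forces
  \<open>y = 0\<close>.
\<close>

lemma square_le_of_quadratic:
  fixes x y z :: real
  assumes quad: "\<And>t. t > 0 \<Longrightarrow> 2 * t * y \<le> x + t\<^sup>2 * z" and "0 \<le> x" "0 \<le> y" "0 \<le> z"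
  shows "y\<^sup>2 \<le> x * z"
proof (cases "y = 0")
  case False
  then have y: "y > 0" using assms by simp
  show ?thesis
  proof (cases "z = 0")
    case True
    have "2 * ((x + 1) / y) * y \<le> x" using quad[of "(x + 1) / y"] y assms(2) True by simp
    then show ?thesis using y assms(2) by simp
  next
    case False
    then have z: "z > 0" using assms by simp
    have "2 * (y / z) * y \<le> x + (y / z)\<^sup>2 * z" using quad[of "y / z"] y z by simp
    then have "y\<^sup>2 / z \<le> x" using z by (simp add: power2_eq_square field_simps)
    then show ?thesis using z by (simp add: pos_divide_le_eq)
  qed
qed (use assms in simp)

text \<open>
  The sequence \<open>f k / c\<close> at least squares in each step, so a ratio \<open>f 0 / c\<close> above \<open>d\<close> would
  outgrow every multiple of \<open>d\<close> to the power \<open>2\<^sup>k\<close>.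
\<close>

lemma geometric_bound:
  fixes f :: "nat \<Rightarrow> real"
  assumes step: "\<And>k. (f k)\<^sup>2 \<le> c * f (Suc k)" and nonneg: "\<And>k. 0 \<le> f k" "0 \<le> c" "0 \<le> d"
    and growth: "\<And>k. f k \<le> K * d ^ 2 ^ k"
  shows "f 0 \<le> d * c"
proof (cases "c = 0")
  case True
  then show ?thesis using step[of 0] by simp
next
  case False
  then have c: "c > 0" using nonneg by simp
  have double: "y ^ 2 ^ Suc k = (y ^ 2 ^ k)\<^sup>2" for y :: real and k
    by (simp add: power_mult[symmetric] mult.commute)
  have it: "f 0 ^ 2 ^ k * c \<le> c ^ 2 ^ k * f k" for k
  proof (induction k)
    case (Suc k)
    have "(f 0 ^ 2 ^ Suc k * c) * c = (f 0 ^ 2 ^ k * c)\<^sup>2"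
      unfolding double by (simp add: power2_eq_square)
    also have "\<dots> \<le> (c ^ 2 ^ k * f k)\<^sup>2" using Suc nonneg by (intro power_mono) auto
    also have "\<dots> = c ^ 2 ^ Suc k * (f k)\<^sup>2"
      unfolding double by (rule power_mult_distrib)
    also have "\<dots> \<le> c ^ 2 ^ Suc k * (c * f (Suc k))" using step nonneg by (intro mult_left_mono) auto
    finally have "(f 0 ^ 2 ^ Suc k * c) * c \<le> (c ^ 2 ^ Suc k * f (Suc k)) * c"
      by (simp only: mult_ac)
    then show ?case using c by (rule mult_right_le_imp_le)
  qed simp
  show ?thesis
  proof (rule le_of_powers_bounded[where K = "K / c"])
    fix m
    have "f 0 ^ 2 ^ m * c \<le> c ^ 2 ^ m * (K * d ^ 2 ^ m)"
      by (rule order_trans[OF it]) (use growth nonneg in \<open>auto intro: mult_left_mono\<close>)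
    then have "f 0 ^ 2 ^ m \<le> K / c * (d * c) ^ 2 ^ m"
      using c by (simp add: power_mult_distrib pos_le_divide_eq mult_ac)
    moreover have "m \<le> 2 ^ m" using less_exp[of m] by linarith
    ultimately show "\<exists>n\<ge>m. f 0 ^ n \<le> K / c * (d * c) ^ n" by blast
  qed (use nonneg in simp)
qed

context hilbert_module
begin

text \<open>
  The arguments of \<open>\<phi>\<close> are an arbitrary matrix \<open>Z\<close>, so that the form is linear in it over the reals and
  the square in \<open>form_square_le\<close> can be expanded entry by entry.
\<close>

definition form :: "('b::complex_star_algebra \<Rightarrow> 'h \<Rightarrow> 'h) \<Rightarrow> nat \<Rightarrow> (nat \<Rightarrow> 'h) \<Rightarrow> (nat \<Rightarrow> nat \<Rightarrow> 'b) \<Rightarrow> 'a" where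
  "form \<phi> n h Z = (\<Sum>i<n. \<Sum>j<n. gram (\<phi> (Z i j) (h j)) (h i))"

lemma form_add:
  assumes "clinear \<phi>"
  shows "form \<phi> n h (\<lambda>i j. Z i j + W i j) = form \<phi> n h Z + form \<phi> n h W"
  by (simp add: form_def clinear_add[OF assms] gram_add_left sum.distrib)

lemma form_scale:
  assumes "clinear \<phi>"
  shows "form \<phi> n h (\<lambda>i j. complex_of_real r *\<^sub>C Z i j) = complex_of_real r *\<^sub>C form \<phi> n h Z"
  by (simp add: form_def clinear_scaleC[OF assms] scaleC_fun_def gram_scaleC_left cvec.scale_sum_right)

text \<open>
  The form at \<open>y\<^sub>i = x\<^sub>i - t a x\<^sub>i\<close> with \<open>a = b\<^sup>*b\<close> is a sum of elements \<open>c\<^sup>*c\<close>; expanding it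
  gives a quadratic inequality in \<open>t\<close>.  It plays the part of the Cauchy--Schwarz inequality for the
  \<open>A\<close>-valued form.
\<close>

lemma form_square_le:
  assumes cp: "completely_positive (adjointables gram) (\<circ>) (adjoint_op gram) \<phi>"
    and p: "cstar_seminorm p"
  shows "(p (form \<phi> n h (\<lambda>i j. star (x i) * star b * b * x j)))\<^sup>2
    \<le> p (form \<phi> n h (\<lambda>i j. star (x i) * x j))
      * p (form \<phi> n h (\<lambda>i j. star (x i) * star (star b * b) * (star b * b) * x j))"
proof -
  note sn = cstar_seminorm_seminorm[OF p]
  have lin: "clinear \<phi>" using cp by (simp add: completely_positive_def)
  define a where "a = star b * b"
  have a: "star a = a" by (simp add: a_def star_simps)
  define X A B where "X = form \<phi> n h (\<lambda>i j. star (x i) * x j)"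
    and "A = form \<phi> n h (\<lambda>i j. star (x i) * a * x j)"
    and "B = form \<phi> n h (\<lambda>i j. star (x i) * a * a * x j)"
  have pos: "form \<phi> n h (\<lambda>i j. star (y i) * y j) \<in> star_sums" for y
    using completely_positive_form_star_sums[OF cp] by (simp add: form_def)
  have A: "A \<in> star_sums" using pos[of "\<lambda>i. b * x i"] by (simp add: A_def a_def star_mult mult.assoc)
  have quad: "2 * t * p A \<le> p X + t\<^sup>2 * p B" if t: "t > 0" for t
  proof -
    let ?t = "complex_of_real t"
    define D where "D = form \<phi> n h (\<lambda>i j. star (x i - ?t *\<^sub>C (a * x i)) * (x j - ?t *\<^sub>C (a * x j)))"
    have "star (x i - ?t *\<^sub>C (a * x i)) * (x j - ?t *\<^sub>C (a * x j))
        = star (x i) * x j + complex_of_real (- (2 * t)) *\<^sub>C (star (x i) * a * x j)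
          + complex_of_real (t\<^sup>2) *\<^sub>C (star (x i) * a * a * x j)" for i j
    proof -
      have two: "complex_of_real (- (2 * t)) *\<^sub>C v = - (?t *\<^sub>C v) - ?t *\<^sub>C v" for v :: 'b
      proof -
        have "complex_of_real (- (2 * t)) = - ?t - ?t" by simp
        then show ?thesis by (simp only: cvec.scale_left_diff_distrib cvec.scale_minus_left)
      qed
      have sq: "complex_of_real (t\<^sup>2) *\<^sub>C v = ?t *\<^sub>C ?t *\<^sub>C v" for v :: 'b
        by (simp add: power2_eq_square)
      have st: "star (x i - ?t *\<^sub>C (a * x i)) = star (x i) - ?t *\<^sub>C (star (x i) * a)"
        by (simp add: star_simps a)
      show ?thesis unfolding two sq st
        by (simp only: left_diff_distrib right_diff_distrib scaleC_mult_left scaleC_mult_right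
            cvec.scale_right_diff_distrib mult.assoc) simp
    qed
    then have "D = X + complex_of_real (- (2 * t)) *\<^sub>C A + complex_of_real (t\<^sup>2) *\<^sub>C B"
      unfolding D_def X_def A_def B_def by (simp only: form_add[OF lin] form_scale[OF lin])
    then have eq: "complex_of_real (2 * t) *\<^sub>C A + D = X + complex_of_real (t\<^sup>2) *\<^sub>C B"
      by simp
    have "p (complex_of_real (2 * t) *\<^sub>C A) \<le> p (complex_of_real (2 * t) *\<^sub>C A + D)"
      by (intro cstar_seminorm_mono p star_sums_scale A) (use t pos in \<open>auto simp: D_def\<close>)
    also have "\<dots> \<le> p X + p (complex_of_real (t\<^sup>2) *\<^sub>C B)" unfolding eq by (rule seminorm_triangle[OF sn])
    finally show ?thesis using t by (simp only: seminorm_scaleC[OF sn] norm_of_real) simp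
  qed
  have "(p A)\<^sup>2 \<le> p X * p B" by (rule square_le_of_quadratic[OF quad]) (auto simp: seminorm_nonneg[OF sn])
  then show ?thesis by (simp add: A_def B_def X_def a_def star_simps mult.assoc)
qed

text \<open>
  The squares \<open>F(b\<^sub>k)\<^sup>2 \<le> F(1) F(b\<^sub>k\<^sub>+\<^sub>1)\<close> feed \<open>geometric_bound\<close>; what remains is that \<open>F(b\<^sub>k)\<close> grows at
  most like \<open>d\<^sup>2\<close> to the power \<open>2\<^sup>k\<close>, which follows entry by entry from \<open>s(b\<^sub>k) = s(b)\<close> to the power
  \<open>2\<^sup>k\<close> and submultiplicativity of the seminorms \<open>s\<close>.
\<close>

lemma form_le:
  fixes \<phi> :: "'b::locally_cstar_algebra \<Rightarrow> 'h \<Rightarrow> 'h"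
  assumes cp: "completely_positive (adjointables gram) (\<circ>) (adjoint_op gram) \<phi>"
    and p: "cstar_seminorm p"
    and F: "finite F" "\<And>s. s \<in> F \<Longrightarrow> cstar_seminorm s" and e: "e > 0"
    and contr: "\<And>z g. (\<And>s. s \<in> F \<Longrightarrow> s z < e) \<Longrightarrow> p (gram (\<phi> z g) (\<phi> z g)) \<le> p (gram g g)"
    and d: "0 \<le> d" "\<And>s. s \<in> F \<Longrightarrow> s b \<le> d"
  shows "p (form \<phi> n h (\<lambda>i j. star (x i) * star b * b * x j))
    \<le> d\<^sup>2 * p (form \<phi> n h (\<lambda>i j. star (x i) * x j))"
proof -
  note sn = cstar_seminorm_seminorm[OF p] and sF = cstar_seminorm_seminorm[OF F(2)]
  have lin: "clinear \<phi>" using cp by (simp add: completely_positive_def)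
  define f where "f k = p (form \<phi> n h (\<lambda>i j. star (x i) * star (iterated_square b k) * iterated_square b k * x j))" for k
  have "\<exists>K\<ge>0. \<forall>z. p (gram (\<phi> z g) k) \<le> K * (\<Sum>s\<in>F. s z)" for g k
    by (rule form_bounded[where e = e]) (fact lin p F e contr)+
  then have "\<forall>i j. \<exists>K\<ge>0. \<forall>z. p (gram (\<phi> z (h j)) (h i)) \<le> K * (\<Sum>s\<in>F. s z)" by blast
  then obtain K where K: "\<And>i j. 0 \<le> K i j" "\<And>i j z. p (gram (\<phi> z (h j)) (h i)) \<le> K i j * (\<Sum>s\<in>F. s z)"
    by metis
  have entry: "s (star (x i) * star (iterated_square b k) * iterated_square b k * x j) \<le> s (x i) * s (x j) * (d\<^sup>2) ^ 2 ^ k"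
    if s: "s \<in> F" for s i j k
  proof -
    interpret cstar_algebra_seminorm s by standard (rule F(2)[OF s])
    let ?b = "iterated_square b k"
    have "s (star (x i) * (star ?b * ?b) * x j) \<le> s (star (x i)) * s (star ?b * ?b) * s (x j)"
      by (rule order_trans[OF p_mult]) (simp add: mult_right_mono p_mult)
    also have "\<dots> = s (x i) * s (x j) * (s ?b)\<^sup>2" by (simp add: p_star p_cstar)
    also have "s ?b = s b ^ 2 ^ k" by (rule cstar_seminorm_iterated_square[OF F(2)[OF s]])
    also have "s (x i) * s (x j) * (s b ^ 2 ^ k)\<^sup>2 \<le> s (x i) * s (x j) * (d ^ 2 ^ k)\<^sup>2"
      using d(2)[OF s] by (intro mult_left_mono power_mono) auto
    also have "(d ^ 2 ^ k)\<^sup>2 = (d\<^sup>2) ^ 2 ^ k" by (simp add: power_mult[symmetric] mult.commute)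
    finally show ?thesis by (simp only: mult.assoc)
  qed
  define M where "M = (\<Sum>i<n. \<Sum>j<n. K i j * (\<Sum>s\<in>F. s (x i) * s (x j)))"
  have growth: "f k \<le> M * (d\<^sup>2) ^ 2 ^ k" for k
  proof -
    let ?z = "\<lambda>i j. star (x i) * star (iterated_square b k) * iterated_square b k * x j"
    have "f k \<le> (\<Sum>i<n. \<Sum>j<n. p (gram (\<phi> (?z i j) (h j)) (h i)))"
      unfolding f_def form_def
      by (rule order_trans[OF seminorm_sum[OF sn]], intro sum_mono seminorm_sum[OF sn])
    also have "\<dots> \<le> (\<Sum>i<n. \<Sum>j<n. K i j * (\<Sum>s\<in>F. s (x i) * s (x j) * (d\<^sup>2) ^ 2 ^ k))"
    proof (intro sum_mono)
      fix i j
      have "(\<Sum>s\<in>F. s (?z i j)) \<le> (\<Sum>s\<in>F. s (x i) * s (x j) * (d\<^sup>2) ^ 2 ^ k)"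
        by (rule sum_mono) (rule entry)
      then show "p (gram (\<phi> (?z i j) (h j)) (h i)) \<le> K i j * (\<Sum>s\<in>F. s (x i) * s (x j) * (d\<^sup>2) ^ 2 ^ k)"
        by (rule order_trans[OF K(2) mult_left_mono]) (rule K(1))
    qed
    also have "\<dots> = M * (d\<^sup>2) ^ 2 ^ k"
      by (simp add: M_def sum_distrib_right mult.assoc)
    finally show ?thesis .
  qed
  have "f 0 \<le> d\<^sup>2 * p (form \<phi> n h (\<lambda>i j. star (x i) * x j))"
  proof (rule geometric_bound[where K = M])
    show "(f k)\<^sup>2 \<le> p (form \<phi> n h (\<lambda>i j. star (x i) * x j)) * f (Suc k)" for k
      unfolding f_def iterated_square.simps by (rule form_square_le[OF cp p])
    show "f k \<le> M * (d\<^sup>2) ^ 2 ^ k" for k by (rule growth)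
  qed (simp_all add: f_def seminorm_nonneg[OF sn])
  then show ?thesis by (simp add: f_def)
qed

end

theorem lemma3p7:
  fixes act :: "'h::{complex_vector,uniform_space} \<Rightarrow> 'a::locally_cstar_algebra \<Rightarrow> 'h"
    and gram :: "'h \<Rightarrow> 'h \<Rightarrow> 'a"
    and \<phi> :: "'b::locally_cstar_algebra \<Rightarrow> 'h \<Rightarrow> 'h"
  assumes "hilbert_module act gram"
    and "continuous_map euclidean (adjointables_topology gram) \<phi>"
    and "completely_positive (adjointables gram) (\<circ>) (adjoint_op gram) \<phi>"
  shows "\<forall>b::'b. \<forall>p\<in>(S\<^sub>* :: ('a \<Rightarrow> real) set). \<exists>c\<ge>0. \<forall>(n::nat) (h::nat \<Rightarrow> 'h) (x::nat \<Rightarrow> 'b).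
    p (\<Sum>i=1..n. \<Sum>j=1..n. gram (\<phi> (star (x i) * star b * b * x j) (h j)) (h i))
      \<le> c * p (\<Sum>i=1..n. \<Sum>j=1..n. gram (\<phi> (star (x i) * x j) (h j)) (h i))"
proof (intro allI ballI)
  fix b :: 'b and p :: "'a \<Rightarrow> real"
  assume p: "p \<in> S\<^sub>*"
  interpret hilbert_module act gram by fact
  have cp: "cstar_seminorm p" using p by (simp add: cont_cstar_seminorms_def)
  have lin: "clinear \<phi>" using assms(3) by (simp add: completely_positive_def)
  show "\<exists>c\<ge>0. \<forall>(n::nat) (h::nat \<Rightarrow> 'h) (x::nat \<Rightarrow> 'b).
    p (\<Sum>i=1..n. \<Sum>j=1..n. gram (\<phi> (star (x i) * star b * b * x j) (h j)) (h i))
      \<le> c * p (\<Sum>i=1..n. \<Sum>j=1..n. gram (\<phi> (star (x i) * x j) (h j)) (h i))"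
  proof (rule continuous_contractive_near_zero[OF assms(2) lin p])
    fix F :: "('b \<Rightarrow> real) set" and e :: real
    assume F: "finite F" "\<And>s. s \<in> F \<Longrightarrow> cstar_seminorm s" "e > 0"
      "\<And>z g. (\<And>s. s \<in> F \<Longrightarrow> s z < e) \<Longrightarrow> p (gram (\<phi> z g) (\<phi> z g)) \<le> p (gram g g)"
    note sF = cstar_seminorm_seminorm[OF F(2)]
    define d where "d = (\<Sum>s\<in>F. s b)"
    have d: "0 \<le> d" unfolding d_def by (rule sum_nonneg) (rule seminorm_nonneg[OF sF])
    have sd: "s b \<le> d" if "s \<in> F" for s
      unfolding d_def by (rule member_le_sum[OF that _ F(1)], rule seminorm_nonneg[OF sF], simp)
    have shift: "(\<Sum>i=1..n. \<Sum>j=1..n. gram (\<phi> (Z i j) (h j)) (h i))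
        = form \<phi> n (\<lambda>i. h (Suc i)) (\<lambda>i j. Z (Suc i) (Suc j))" for n h and Z :: "nat \<Rightarrow> nat \<Rightarrow> 'b"
      by (simp add: form_def sum.atLeast1_atMost_eq)
    show ?thesis
      unfolding shift
    proof (rule exI[of _ "d\<^sup>2"], intro conjI allI)
      fix n :: nat and h :: "nat \<Rightarrow> 'h" and x :: "nat \<Rightarrow> 'b"
      show "p (form \<phi> n (\<lambda>i. h (Suc i)) (\<lambda>i j. star (x (Suc i)) * star b * b * x (Suc j)))
          \<le> d\<^sup>2 * p (form \<phi> n (\<lambda>i. h (Suc i)) (\<lambda>i j. star (x (Suc i)) * x (Suc j)))"
        by (rule form_le[where F = F and e = e]) (fact assms(3) cp F d sd)+
    qed simp
  qed
qed

end
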